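(* Let $k$ be a commutative ring with unit, and let $A$ be an associative unital $k$-algebra with a free $k$-module basis $\mathcal{B}=\{\varphi_\omega\mid\omega\in\Omega\}$ such that for all $\alpha,\beta\in\Omega$ there are $\varphi_m\in\mathcal{B}$ and an idempotent $\mu_{\alpha,\beta}\in k$ with $\varphi_\alpha\varphi_\beta=\mu_{\alpha,\beta}\varphi_m$. The cochain map $\Psi:\mathrm{Hom}_k(A^{\otimes *},k)\to AP(A^{\otimes *},A)$ is a map of (differential graded) algebras, i.e. for all $\alpha\in\mathrm{Hom}_k(A^{\otimes p},k)$ and $\beta\in\mathrm{Hom}_k(A^{\otimes q},k)$, $$\Psi(\alpha\underset{S}{\cdot}\beta)=\Psi(\alpha)\underset{G}{\cdot}\Psi(\beta).$$
   Context: $e\in A$ denotes the unit, $\Omega$ is an arbitrary index set, $\mu\in k$ is idempotent if $\mu^2=\mu$. Tensor products are over $k$, with $A^{\otimes 0}=k$. $AP(A^{\otimes n},A)\subseteq\mathrm{Hom}_k(A^{\otimes n},A)$ is the submodule of (strictly) autopoietic cochains: for $n\ge1$, those $f$ such that for all $\varphi_1,\dots,\varphi_n\in\mathcal{B}$ there is $\lambda_{\varphi_1,\dots,\varphi_n}\in k$ with $f(\varphi_1\otimes\cdots\otimes\varphi_n)=\lambda_{\varphi_1,\dots,\varphi_n}(\varphi_1\cdots\varphi_n)$; for $n=0$, those $f$ with $f(1)=\lambda e$ for some $\lambda\in k$. For $\alpha\in\mathrm{Hom}_k(A^{\otimes n},k)$, $\Psi(\alpha)$ is the $k$-linear map determined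 on basis elements by $\Psi(\alpha)(\varphi_1\otimes\cdots\otimes\varphi_n)=\alpha(\varphi_1\otimes\cdots\otimes\varphi_n)\cdot(\varphi_1\varphi_2\cdots\varphi_n)$ (for $n=0$, $\Psi(\alpha)(1)=\alpha(1)e$). The simplicial cup product $\alpha\underset{S}{\cdot}\beta\in\mathrm{Hom}_k(A^{\otimes(p+q)},k)$ is (front $p$-face times back $q$-face) $$(\alpha\underset{S}{\cdot}\beta)(\varphi_1\otimes\cdots\otimes\varphi_{p+q})=\alpha(\varphi_1\otimes\cdots\otimes\varphi_p)\,\beta(\varphi_{p+1}\otimes\cdots\otimes\varphi_{p+q}),$$ and the Gerstenhaber product of $f\in\mathrm{Hom}_k(A^{\otimes p},A)$ and $g\in\mathrm{Hom}_k(A^{\otimes q},A)$ is $$(f\underset{G}{\cdot}g)(a_1\otimes\cdots\otimes a_{p+q})=f(a_1\otimes\cdots\otimes a_p)\,g(a_{p+1}\otimes\cdots\otimes a_{p+q}).$$ *)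

theory Defs
  imports "HOL-Algebra.Module" "HOL-Algebra.AbelCoset"
begin

text \<open>
  The library locale \<^locale>\<open>algebra\<close> demands a commutative multiplication; here the algebra is
  only associative and unital, so centrality of the scalars has to be stated on both sides.
\<close>

locale unital_algebra = module k A + ring A
  for k :: "('r, 'm) ring_scheme" (structure) and A :: "('r, 'a, 'n) module_scheme" (structure) +
  assumes smult_mult_left:
      "\<lbrakk>r \<in> carrier k; x \<in> carrier A; y \<in> carrier A\<rbrakk> \<Longrightarrow>
        (r \<odot>\<^bsub>A\<^esub> x) \<otimes>\<^bsub>A\<^esub> y = r \<odot>\<^bsub>A\<^esub> (x \<otimes>\<^bsub>A\<^esub> y)"
    and smult_mult_right:
      "\<lbrakk>r \<in> carrier k; x \<in> carrier A; y \<in> carrier A\<rbrakk> \<Longrightarrow>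
        x \<otimes>\<^bsub>A\<^esub> (r \<odot>\<^bsub>A\<^esub> y) = r \<odot>\<^bsub>A\<^esub> (x \<otimes>\<^bsub>A\<^esub> y)"

text \<open>
  Linear maps are made extensional (value \<^term>\<open>undefined\<close> off the carrier), so that HOL equality
  of two elements of \<open>Hom_mod k M N\<close> is equality of linear maps.
\<close>

definition Hom_mod ::
  "('r, 'm) ring_scheme \<Rightarrow> ('r, 'a, 'n) module_scheme \<Rightarrow> ('r, 'b, 'o) module_scheme \<Rightarrow> ('a \<Rightarrow> 'b) set"
  where "Hom_mod k M N =
    {f \<in> carrier M \<rightarrow>\<^sub>E carrier N.
       (\<forall>x \<in> carrier M. \<forall>y \<in> carrier M. f (x \<oplus>\<^bsub>M\<^esub> y) = f x \<oplus>\<^bsub>N\<^esub> f y) \<and>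
       (\<forall>r \<in> carrier k. \<forall>x \<in> carrier M. f (r \<odot>\<^bsub>M\<^esub> x) = r \<odot>\<^bsub>N\<^esub> f x)}"

definition self_module :: "('r, 'm) ring_scheme \<Rightarrow> ('r, 'r) module"
  where "self_module k =
    \<lparr>carrier = carrier k, mult = mult k, one = one k, zero = zero k, add = add k,
     smult = mult k\<rparr>"

text \<open>
  The record type of modules extends that of rings; the ring fields \<open>mult\<close> and \<open>one\<close> are irrelevant
  for the modules built below and are left unspecified.
\<close>

definition free_mod :: "('r, 'm) ring_scheme \<Rightarrow> 'x set \<Rightarrow> ('r, 'x \<Rightarrow> 'r) module"
  where "free_mod k X =
    \<lparr>carrier = {c. (\<forall>x \<in> X. c x \<in> carrier k) \<and> (\<forall>x. x \<notin> X \<longrightarrow> c x = \<zero>\<^bsub>k\<^esub>) \<and>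
                   finite {x. c x \<noteq> \<zero>\<^bsub>k\<^esub>}},
     mult = undefined, one = undefined,
     zero = (\<lambda>_. \<zero>\<^bsub>k\<^esub>),
     add = (\<lambda>c d x. c x \<oplus>\<^bsub>k\<^esub> d x),
     smult = (\<lambda>r c x. r \<otimes>\<^bsub>k\<^esub> c x)\<rparr>"

definition free_gen :: "('r, 'm) ring_scheme \<Rightarrow> 'x \<Rightarrow> 'x \<Rightarrow> 'r"
  where "free_gen k x = (\<lambda>y. if y = x then \<one>\<^bsub>k\<^esub> else \<zero>\<^bsub>k\<^esub>)"

definition gen_submodule ::
  "('r, 'm) ring_scheme \<Rightarrow> ('r, 'a, 'n) module_scheme \<Rightarrow> 'a set \<Rightarrow> 'a set"
  where "gen_submodule k M S = \<Inter>{H. submodule H k M \<and> S \<subseteq> H}"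

definition quot_mod :: "('r, 'a, 'n) module_scheme \<Rightarrow> 'a set \<Rightarrow> ('r, 'a set) module"
  where "quot_mod M H =
    \<lparr>carrier = a_rcosets\<^bsub>M\<^esub> H,
     mult = undefined, one = undefined,
     zero = H,
     add = set_add M,
     smult = (\<lambda>r C. \<Union>x \<in> C. H +>\<^bsub>M\<^esub> (r \<odot>\<^bsub>M\<^esub> x))\<rparr>"

definition tuples :: "nat \<Rightarrow> 'a set \<Rightarrow> 'a list set"
  where "tuples n S = {xs. length xs = n \<and> set xs \<subseteq> S}"

text \<open>
  The tensor power is the free module on \<open>n\<close>-tuples modulo the submodule generated by the
  multilinearity relations. For \<open>n = 0\<close> there are no relations and the result is the free module of
  rank one on the empty tuple, i.e. \<open>k\<close> itself, with \<open>1\<close> corresponding to \<open>pure_tensor k A []\<close>.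
\<close>

definition tensor_relations ::
  "('r, 'm) ring_scheme \<Rightarrow> ('r, 'a, 'n) module_scheme \<Rightarrow> nat \<Rightarrow> ('a list \<Rightarrow> 'r) set"
  where "tensor_relations k A n =
    (let F = free_mod k (tuples n (carrier A)); \<delta> = free_gen k in
      {\<delta> (us @ (x \<oplus>\<^bsub>A\<^esub> y) # vs) \<ominus>\<^bsub>F\<^esub> (\<delta> (us @ x # vs) \<oplus>\<^bsub>F\<^esub> \<delta> (us @ y # vs)) | us x y vs.
         us @ x # vs \<in> tuples n (carrier A) \<and> y \<in> carrier A} \<union>
      {\<delta> (us @ (r \<odot>\<^bsub>A\<^esub> x) # vs) \<ominus>\<^bsub>F\<^esub> r \<odot>\<^bsub>F\<^esub> \<delta> (us @ x # vs) | us r x vs.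
         us @ x # vs \<in> tuples n (carrier A) \<and> r \<in> carrier k})"

definition tensor_kernel ::
  "('r, 'm) ring_scheme \<Rightarrow> ('r, 'a, 'n) module_scheme \<Rightarrow> nat \<Rightarrow> ('a list \<Rightarrow> 'r) set"
  where "tensor_kernel k A n =
    gen_submodule k (free_mod k (tuples n (carrier A))) (tensor_relations k A n)"

definition tensor_power ::
  "('r, 'm) ring_scheme \<Rightarrow> ('r, 'a, 'n) module_scheme \<Rightarrow> nat \<Rightarrow> ('r, ('a list \<Rightarrow> 'r) set) module"
  where "tensor_power k A n =
    quot_mod (free_mod k (tuples n (carrier A))) (tensor_kernel k A n)"

definition pure_tensor ::
  "('r, 'm) ring_scheme \<Rightarrow> ('r, 'a, 'n) module_scheme \<Rightarrow> 'a list \<Rightarrow> ('a list \<Rightarrow> 'r) set"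
  where "pure_tensor k A xs =
    tensor_kernel k A (length xs)
      +>\<^bsub>free_mod k (tuples (length xs) (carrier A))\<^esub> free_gen k xs"

definition free_basis ::
  "('r, 'm) ring_scheme \<Rightarrow> ('r, 'a, 'n) module_scheme \<Rightarrow> 'i set \<Rightarrow> ('i \<Rightarrow> 'a) \<Rightarrow> bool"
  where "free_basis k A \<Omega> \<phi> \<longleftrightarrow>
    \<phi> \<in> \<Omega> \<rightarrow> carrier A \<and>
    (\<forall>a \<in> carrier A. \<exists>!c. c \<in> carrier (free_mod k \<Omega>) \<and>
       a = (\<Oplus>\<^bsub>A\<^esub>\<omega> \<in> {\<omega> \<in> \<Omega>. c \<omega> \<noteq> \<zero>\<^bsub>k\<^esub>}. c \<omega> \<odot>\<^bsub>A\<^esub> \<phi> \<omega>))"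

definition list_prod :: "('a, 'm) monoid_scheme \<Rightarrow> 'a list \<Rightarrow> 'a"
  where "list_prod A xs = foldr (mult A) xs \<one>\<^bsub>A\<^esub>"

definition AP ::
  "('r, 'm) ring_scheme \<Rightarrow> ('r, 'a, 'n) module_scheme \<Rightarrow> 'a set \<Rightarrow> nat
    \<Rightarrow> (('a list \<Rightarrow> 'r) set \<Rightarrow> 'a) set"
  where "AP k A B n =
    {f \<in> Hom_mod k (tensor_power k A n) A.
       \<forall>bs \<in> tuples n B. \<exists>l \<in> carrier k. f (pure_tensor k A bs) = l \<odot>\<^bsub>A\<^esub> list_prod A bs}"

text \<open>
  The next three maps are determined by linearity from their values on (basis) tensors, hence the
  definite descriptions. The degrees are explicit arguments, as they cannot be recovered from
  the types.
\<close>

definition Psi ::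
  "('r, 'm) ring_scheme \<Rightarrow> ('r, 'a, 'n) module_scheme \<Rightarrow> 'a set \<Rightarrow> nat
    \<Rightarrow> (('a list \<Rightarrow> 'r) set \<Rightarrow> 'r) \<Rightarrow> (('a list \<Rightarrow> 'r) set \<Rightarrow> 'a)"
  where "Psi k A B n \<alpha> =
    (THE f. f \<in> Hom_mod k (tensor_power k A n) A \<and>
       (\<forall>bs \<in> tuples n B.
          f (pure_tensor k A bs) = \<alpha> (pure_tensor k A bs) \<odot>\<^bsub>A\<^esub> list_prod A bs))"

definition simplicial_cup ::
  "('r, 'm) ring_scheme \<Rightarrow> ('r, 'a, 'n) module_scheme \<Rightarrow> 'a set \<Rightarrow> nat \<Rightarrow> nat
    \<Rightarrow> (('a list \<Rightarrow> 'r) set \<Rightarrow> 'r) \<Rightarrow> (('a list \<Rightarrow> 'r) set \<Rightarrow> 'r)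
    \<Rightarrow> (('a list \<Rightarrow> 'r) set \<Rightarrow> 'r)"
  where "simplicial_cup k A B p q \<alpha> \<beta> =
    (THE \<gamma>. \<gamma> \<in> Hom_mod k (tensor_power k A (p + q)) (self_module k) \<and>
       (\<forall>us \<in> tuples p B. \<forall>vs \<in> tuples q B.
          \<gamma> (pure_tensor k A (us @ vs)) = \<alpha> (pure_tensor k A us) \<otimes>\<^bsub>k\<^esub> \<beta> (pure_tensor k A vs)))"

definition gerstenhaber_cup ::
  "('r, 'm) ring_scheme \<Rightarrow> ('r, 'a, 'n) module_scheme \<Rightarrow> nat \<Rightarrow> nat
    \<Rightarrow> (('a list \<Rightarrow> 'r) set \<Rightarrow> 'a) \<Rightarrow> (('a list \<Rightarrow> 'r) set \<Rightarrow> 'a)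
    \<Rightarrow> (('a list \<Rightarrow> 'r) set \<Rightarrow> 'a)"
  where "gerstenhaber_cup k A p q f g =
    (THE h. h \<in> Hom_mod k (tensor_power k A (p + q)) A \<and>
       (\<forall>us \<in> tuples p (carrier A). \<forall>vs \<in> tuples q (carrier A).
          h (pure_tensor k A (us @ vs)) = f (pure_tensor k A us) \<otimes>\<^bsub>A\<^esub> g (pure_tensor k A vs)))"

end

theory Submission
  imports Defs
begin

text \<open>
A linear map on a tensor power of \<open>A\<close> is determined by its values on pure tensors of basis elements,
so the identity needs checking only at a concatenation \<open>us @ vs\<close> of a basis \<open>p\<close>-tuple and a basis
\<open>q\<close>-tuple. There the right-hand side is \<open>(\<alpha>(us) u) (\<beta>(vs) v)\<close>, where \<open>u\<close> and \<open>v\<close> are the products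
of the two tuples in \<open>A\<close>. Scalars are central, so this is \<open>(\<alpha>(us) \<beta>(vs)) (u v)\<close>, and by
associativity \<open>u v\<close> is the product of \<open>us @ vs\<close>. The result is the value of the left-hand side.

The substance of the proof is that the maps involved exist, since all of them are specified by
their values on certain pure tensors. Two facts are used. First, multilinear maps factor through
the tensor power (\<open>tensor_lift\<close>), which follows from the universal properties of free modules and
of quotients. Applied to the product of two multilinear maps (\<open>multilinear_mult\<close>), it gives the
Gerstenhaber product. Second, any assignment of values to basis tuples extends uniquely to a linear
map on the tensor power (\<open>tensor_Hom_mod_ex1_on_basis\<close>): expand the entries of a tuple in the basis
one after the other. This gives \<open>\<Psi>\<close> and the simplicial product.
\<close>

section \<open>Linear combinations and free modules\<close>

text \<open>
The finite linear combination with coefficients \<open>c\<close> of the vectors \<open>g x\<close>. The sum runs over the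
support of \<open>c\<close>, so the index set need not be mentioned; values of \<open>g\<close> off the support are
irrelevant.
\<close>

definition lincomb ::
  "('r, 'm) ring_scheme \<Rightarrow> ('r, 'a, 'n) module_scheme \<Rightarrow> ('x \<Rightarrow> 'r) \<Rightarrow> ('x \<Rightarrow> 'a) \<Rightarrow> 'a"
  where "lincomb k M c g = (\<Oplus>\<^bsub>M\<^esub>x \<in> {x. c x \<noteq> \<zero>\<^bsub>k\<^esub>}. c x \<odot>\<^bsub>M\<^esub> g x)"

lemma free_mod_simps [simp]:
  "zero (free_mod k X) = (\<lambda>_. \<zero>\<^bsub>k\<^esub>)"
  "add (free_mod k X) = (\<lambda>c d x. c x \<oplus>\<^bsub>k\<^esub> d x)"
  "smult (free_mod k X) = (\<lambda>r c x. r \<otimes>\<^bsub>k\<^esub> c x)"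
  by (simp_all add: free_mod_def)

lemma free_mod_carrier_iff:
  "c \<in> carrier (free_mod k X) \<longleftrightarrow>
    (\<forall>x \<in> X. c x \<in> carrier k) \<and> (\<forall>x. x \<notin> X \<longrightarrow> c x = \<zero>\<^bsub>k\<^esub>) \<and> finite {x. c x \<noteq> \<zero>\<^bsub>k\<^esub>}"
  by (simp add: free_mod_def)

lemma (in cring) free_mod_apply_closed:
  "c \<in> carrier (free_mod R X) \<Longrightarrow> c x \<in> carrier R"
  by (cases "x \<in> X") (auto simp: free_mod_carrier_iff)

lemma (in cring) free_mod_closed:
  assumes "c \<in> carrier (free_mod R X)" "d \<in> carrier (free_mod R X)"
  shows "(\<lambda>x. c x \<oplus> d x) \<in> carrier (free_mod R X)"
proof -
  have "{x. c x \<oplus> d x \<noteq> \<zero>} \<subseteq> {x. c x \<noteq> \<zero>} \<union> {x. d x \<noteq> \<zero>}"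
    by auto
  with assms show ?thesis
    by (auto simp: free_mod_carrier_iff intro: finite_subset)
qed

lemma (in cring) free_mod_smult_closed:
  assumes "r \<in> carrier R" "c \<in> carrier (free_mod R X)"
  shows "(\<lambda>x. r \<otimes> c x) \<in> carrier (free_mod R X)"
proof -
  have "{x. r \<otimes> c x \<noteq> \<zero>} \<subseteq> {x. c x \<noteq> \<zero>}"
    using assms by auto
  with assms show ?thesis
    by (auto simp: free_mod_carrier_iff intro: finite_subset)
qed

lemma (in cring) free_gen_closed:
  assumes "x \<in> X"
  shows "free_gen R x \<in> carrier (free_mod R X)"
proof -
  have "{y. free_gen R x y \<noteq> \<zero>} \<subseteq> {x}"
    by (auto simp: free_gen_def)
  with assms show ?thesis
    by (auto simp: free_mod_carrier_iff free_gen_def intro: finite_subset)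
qed

lemma (in cring) free_mod_module: "module R (free_mod R X)"
proof (rule moduleI)
  let ?F = "free_mod R X"
  show "abelian_group ?F"
  proof (rule abelian_groupI)
    fix c assume c: "c \<in> carrier ?F"
    have "(\<lambda>x. \<ominus> \<one> \<otimes> c x) \<oplus>\<^bsub>?F\<^esub> c = \<zero>\<^bsub>?F\<^esub>"
      using c by (auto simp: fun_eq_iff free_mod_apply_closed l_minus l_neg)
    then show "\<exists>d \<in> carrier ?F. d \<oplus>\<^bsub>?F\<^esub> c = \<zero>\<^bsub>?F\<^esub>"
      using c free_mod_smult_closed[of "\<ominus> \<one>" c X] by auto
  qed (auto simp: free_mod_closed free_mod_apply_closed a_ac fun_eq_iff
      free_mod_carrier_iff[of "\<lambda>_. \<zero>"])
qed (auto simp: free_mod_smult_closed free_mod_apply_closed is_cring l_distr r_distr m_assoc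
       fun_eq_iff)

lemma (in module) lincomb_superset:
  assumes "c \<in> carrier (free_mod R X)" "g \<in> X \<rightarrow> carrier M"
    and "finite S" "{x. c x \<noteq> \<zero>} \<subseteq> S" "S \<subseteq> X"
  shows "lincomb R M c g = (\<Oplus>\<^bsub>M\<^esub>x \<in> S. c x \<odot>\<^bsub>M\<^esub> g x)"
  unfolding lincomb_def
  using assms
  by (intro M.add.finprod_mono_neutral_cong_left)
     (auto simp: R.free_mod_apply_closed Pi_iff subset_iff)

lemma free_mod_support:
  assumes "c \<in> carrier (free_mod k X)"
  shows "finite {x. c x \<noteq> \<zero>\<^bsub>k\<^esub>}" "{x. c x \<noteq> \<zero>\<^bsub>k\<^esub>} \<subseteq> X"
  using assms by (auto simp: free_mod_carrier_iff)

lemma (in module) lincomb_closed: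
  assumes "c \<in> carrier (free_mod R X)" "g \<in> X \<rightarrow> carrier M"
  shows "lincomb R M c g \<in> carrier M"
  unfolding lincomb_def using assms free_mod_support[OF assms(1)]
  by (intro M.finsum_closed) (auto simp: R.free_mod_apply_closed Pi_iff intro!: smult_closed)

lemma (in module) lincomb_add:
  assumes c: "c \<in> carrier (free_mod R X)" and d: "d \<in> carrier (free_mod R X)"
    and g: "g \<in> X \<rightarrow> carrier M"
  shows "lincomb R M (\<lambda>x. c x \<oplus> d x) g = lincomb R M c g \<oplus>\<^bsub>M\<^esub> lincomb R M d g"
proof -
  let ?S = "{x. c x \<noteq> \<zero>} \<union> {x. d x \<noteq> \<zero>}"
  have S: "finite ?S" "?S \<subseteq> X"
    using free_mod_support[OF c] free_mod_support[OF d] by auto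
  have gS: "g x \<in> carrier M" if "x \<in> ?S" for x
    using that S(2) g by auto
  have "lincomb R M (\<lambda>x. c x \<oplus> d x) g = (\<Oplus>\<^bsub>M\<^esub>x \<in> ?S. (c x \<oplus> d x) \<odot>\<^bsub>M\<^esub> g x)"
    by (rule lincomb_superset[OF R.free_mod_closed[OF c d] g S(1) _ S(2)]) auto
  also have "\<dots> = (\<Oplus>\<^bsub>M\<^esub>x \<in> ?S. c x \<odot>\<^bsub>M\<^esub> g x \<oplus>\<^bsub>M\<^esub> d x \<odot>\<^bsub>M\<^esub> g x)"
    using gS by (intro M.finsum_cong')
      (auto simp: smult_l_distr R.free_mod_apply_closed[OF c] R.free_mod_apply_closed[OF d])
  also have "\<dots> = (\<Oplus>\<^bsub>M\<^esub>x \<in> ?S. c x \<odot>\<^bsub>M\<^esub> g x) \<oplus>\<^bsub>M\<^esub> (\<Oplus>\<^bsub>M\<^esub>x \<in> ?S. d x \<odot>\<^bsub>M\<^esub> g x)"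
    using gS by (intro M.finsum_addf)
      (auto simp: R.free_mod_apply_closed[OF c] R.free_mod_apply_closed[OF d])
  also have "\<dots> = lincomb R M c g \<oplus>\<^bsub>M\<^esub> lincomb R M d g"
    using lincomb_superset[OF c g S(1) _ S(2)] lincomb_superset[OF d g S(1) _ S(2)] by simp
  finally show ?thesis .
qed

lemma (in module) lincomb_smult:
  assumes r: "r \<in> carrier R" and c: "c \<in> carrier (free_mod R X)"
    and g: "g \<in> X \<rightarrow> carrier M"
  shows "lincomb R M (\<lambda>x. r \<otimes> c x) g = r \<odot>\<^bsub>M\<^esub> lincomb R M c g"
proof -
  let ?S = "{x. c x \<noteq> \<zero>}"
  note S = free_mod_support[OF c]
  have gS: "g x \<in> carrier M" if "x \<in> ?S" for x
    using that S(2) g by auto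
  have "lincomb R M (\<lambda>x. r \<otimes> c x) g = (\<Oplus>\<^bsub>M\<^esub>x \<in> ?S. (r \<otimes> c x) \<odot>\<^bsub>M\<^esub> g x)"
    by (rule lincomb_superset[OF R.free_mod_smult_closed[OF r c] g S(1) _ S(2)])
      (use r in auto)
  also have "\<dots> = (\<Oplus>\<^bsub>M\<^esub>x \<in> ?S. r \<odot>\<^bsub>M\<^esub> (c x \<odot>\<^bsub>M\<^esub> g x))"
    using gS r by (intro M.finsum_cong')
      (auto simp: smult_assoc1 R.free_mod_apply_closed[OF c])
  also have "\<dots> = r \<odot>\<^bsub>M\<^esub> lincomb R M c g"
    unfolding lincomb_def using gS r S(1)
    by (intro finsum_smult_ldistr[symmetric]) (auto simp: R.free_mod_apply_closed[OF c])
  finally show ?thesis .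
qed

lemma (in module) lincomb_free_gen:
  assumes x: "x \<in> X" and g: "g \<in> X \<rightarrow> carrier M"
  shows "lincomb R M (free_gen R x) g = g x"
proof -
  have "lincomb R M (free_gen R x) g = (\<Oplus>\<^bsub>M\<^esub>y \<in> {x}. free_gen R x y \<odot>\<^bsub>M\<^esub> g y)"
    by (rule lincomb_superset[OF R.free_gen_closed[OF x] g]) (use x in \<open>auto simp: free_gen_def\<close>)
  also have "\<dots> = g x"
    using g x by (auto simp: free_gen_def Pi_iff)
  finally show ?thesis .
qed

lemma (in module) lincomb_cong:
  assumes "c \<in> carrier (free_mod R X)" "h \<in> X \<rightarrow> carrier M" "\<And>x. x \<in> X \<Longrightarrow> g x = h x"
  shows "lincomb R M c g = lincomb R M c h"
  unfolding lincomb_def using assms free_mod_support[OF assms(1)]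
  by (intro M.finsum_cong') (auto simp: R.free_mod_apply_closed Pi_iff intro!: smult_closed)

lemma (in module) lincomb_add_right:
  assumes c: "c \<in> carrier (free_mod R X)"
    and g: "g \<in> X \<rightarrow> carrier M" and h: "h \<in> X \<rightarrow> carrier M"
  shows "lincomb R M c (\<lambda>x. g x \<oplus>\<^bsub>M\<^esub> h x) = lincomb R M c g \<oplus>\<^bsub>M\<^esub> lincomb R M c h"
proof -
  let ?S = "{x. c x \<noteq> \<zero>}"
  have gS: "g x \<in> carrier M" "h x \<in> carrier M" if "x \<in> ?S" for x
    using that free_mod_support(2)[OF c] g h by auto
  have "lincomb R M c (\<lambda>x. g x \<oplus>\<^bsub>M\<^esub> h x)
      = (\<Oplus>\<^bsub>M\<^esub>x \<in> ?S. c x \<odot>\<^bsub>M\<^esub> g x \<oplus>\<^bsub>M\<^esub> c x \<odot>\<^bsub>M\<^esub> h x)"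
    unfolding lincomb_def using gS
    by (intro M.finsum_cong') (auto simp: smult_r_distr R.free_mod_apply_closed[OF c])
  also have "\<dots> = lincomb R M c g \<oplus>\<^bsub>M\<^esub> lincomb R M c h"
    unfolding lincomb_def using gS
    by (intro M.finsum_addf) (auto simp: R.free_mod_apply_closed[OF c])
  finally show ?thesis .
qed

lemma (in module) lincomb_smult_right:
  assumes c: "c \<in> carrier (free_mod R X)" and r: "r \<in> carrier R"
    and g: "g \<in> X \<rightarrow> carrier M"
  shows "lincomb R M c (\<lambda>x. r \<odot>\<^bsub>M\<^esub> g x) = r \<odot>\<^bsub>M\<^esub> lincomb R M c g"
proof -
  let ?S = "{x. c x \<noteq> \<zero>}"
  have gS: "g x \<in> carrier M" if "x \<in> ?S" for x
    using that free_mod_support(2)[OF c] g by auto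
  have "lincomb R M c (\<lambda>x. r \<odot>\<^bsub>M\<^esub> g x) = (\<Oplus>\<^bsub>M\<^esub>x \<in> ?S. r \<odot>\<^bsub>M\<^esub> (c x \<odot>\<^bsub>M\<^esub> g x))"
    unfolding lincomb_def using gS r
    by (intro M.finsum_cong')
      (auto simp: smult_assoc1[symmetric] R.m_comm R.free_mod_apply_closed[OF c])
  also have "\<dots> = r \<odot>\<^bsub>M\<^esub> lincomb R M c g"
    unfolding lincomb_def using gS r free_mod_support(1)[OF c]
    by (intro finsum_smult_ldistr[symmetric]) (auto simp: R.free_mod_apply_closed[OF c])
  finally show ?thesis .
qed

lemma (in module) submodule_zero: "submodule H R M \<Longrightarrow> \<zero>\<^bsub>M\<^esub> \<in> H"
  using subgroup.one_closed[OF submodule.axioms(1)] by fastforce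

lemma (in module) submodule_lincomb:
  assumes H: "submodule H R M" and c: "c \<in> carrier (free_mod R X)" and g: "g \<in> X \<rightarrow> H"
  shows "lincomb R M c g \<in> H"
proof -
  have "(\<Oplus>\<^bsub>M\<^esub>x \<in> S. c x \<odot>\<^bsub>M\<^esub> g x) \<in> H" if "finite S" "S \<subseteq> X" for S
    using that
  proof (induction S)
    case empty
    then show ?case using submodule_zero[OF H] by simp
  next
    case (insert x S)
    have *: "c y \<odot>\<^bsub>M\<^esub> g y \<in> H" if "y \<in> insert x S" for y
      using that insert.prems g submoduleE(4)[OF H] R.free_mod_apply_closed[OF c] by blast
    then have "c y \<odot>\<^bsub>M\<^esub> g y \<in> carrier M" if "y \<in> insert x S" for y
      using that submoduleE(1)[OF H] by blast
    then have "(\<Oplus>\<^bsub>M\<^esub>x \<in> insert x S. c x \<odot>\<^bsub>M\<^esub> g x)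
        = c x \<odot>\<^bsub>M\<^esub> g x \<oplus>\<^bsub>M\<^esub> (\<Oplus>\<^bsub>M\<^esub>x \<in> S. c x \<odot>\<^bsub>M\<^esub> g x)"
      using insert.hyps by (intro M.finsum_insert) auto
    then show ?case
      using * insert submoduleE(5)[OF H] by auto
  qed
  then show ?thesis
    unfolding lincomb_def using free_mod_support[OF c] by blast
qed

lemma (in cring) lincomb_free_gens:
  assumes c: "c \<in> carrier (free_mod R X)"
  shows "lincomb R (free_mod R X) c (free_gen R) = c"
proof -
  interpret F: module R "free_mod R X" by (rule free_mod_module)
  have "(\<Oplus>\<^bsub>free_mod R X\<^esub>x \<in> S. c x \<odot>\<^bsub>free_mod R X\<^esub> free_gen R x)
      = (\<lambda>y. if y \<in> S then c y else \<zero>)" if "finite S" "S \<subseteq> X" for S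
    using that
  proof (induction S)
    case empty
    then show ?case by simp
  next
    case (insert x S)
    have *: "c y \<odot>\<^bsub>free_mod R X\<^esub> free_gen R y \<in> carrier (free_mod R X)" if "y \<in> insert x S" for y
      using that insert.prems
      by (intro F.smult_closed free_mod_apply_closed[OF c] free_gen_closed) auto
    then have "(\<Oplus>\<^bsub>free_mod R X\<^esub>x \<in> insert x S. c x \<odot>\<^bsub>free_mod R X\<^esub> free_gen R x)
        = c x \<odot>\<^bsub>free_mod R X\<^esub> free_gen R x \<oplus>\<^bsub>free_mod R X\<^esub>
          (\<Oplus>\<^bsub>free_mod R X\<^esub>x \<in> S. c x \<odot>\<^bsub>free_mod R X\<^esub> free_gen R x)"
      using insert.hyps by (intro F.M.finsum_insert) auto
    also have "\<dots> = (\<lambda>y. if y \<in> insert x S then c y else \<zero>)"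
      using insert free_mod_apply_closed[OF c] by (auto simp: free_gen_def fun_eq_iff)
    finally show ?case .
  qed
  from this[OF free_mod_support[OF c]] show ?thesis
    unfolding lincomb_def by auto
qed

section \<open>Linear maps and submodules\<close>

lemma Hom_mod_closed: "f \<in> Hom_mod k M N \<Longrightarrow> x \<in> carrier M \<Longrightarrow> f x \<in> carrier N"
  by (auto simp: Hom_mod_def)

lemma Hom_mod_add:
  "\<lbrakk>f \<in> Hom_mod k M N; x \<in> carrier M; y \<in> carrier M\<rbrakk> \<Longrightarrow> f (x \<oplus>\<^bsub>M\<^esub> y) = f x \<oplus>\<^bsub>N\<^esub> f y"
  by (auto simp: Hom_mod_def)

lemma Hom_mod_smult:
  "\<lbrakk>f \<in> Hom_mod k M N; r \<in> carrier k; x \<in> carrier M\<rbrakk> \<Longrightarrow> f (r \<odot>\<^bsub>M\<^esub> x) = r \<odot>\<^bsub>N\<^esub> f x"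
  by (auto simp: Hom_mod_def)

lemma Hom_mod_zero:
  assumes "module k M" "module k N" "f \<in> Hom_mod k M N"
  shows "f \<zero>\<^bsub>M\<^esub> = \<zero>\<^bsub>N\<^esub>"
proof -
  interpret M: module k M by fact
  interpret N: module k N by fact
  have "f (\<zero>\<^bsub>k\<^esub> \<odot>\<^bsub>M\<^esub> \<zero>\<^bsub>M\<^esub>) = \<zero>\<^bsub>k\<^esub> \<odot>\<^bsub>N\<^esub> f \<zero>\<^bsub>M\<^esub>"
    by (rule Hom_mod_smult[OF assms(3)]) auto
  then show ?thesis
    using Hom_mod_closed[OF assms(3)] by simp
qed

lemma (in module) a_inv_eq_smult: "x \<in> carrier M \<Longrightarrow> \<ominus>\<^bsub>M\<^esub> x = (\<ominus> \<one>) \<odot>\<^bsub>M\<^esub> x"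
  by (simp add: smult_l_minus)

lemma (in module) minus_eq_zero_iff:
  assumes "x \<in> carrier M" "y \<in> carrier M"
  shows "x \<ominus>\<^bsub>M\<^esub> y = \<zero>\<^bsub>M\<^esub> \<longleftrightarrow> x = y"
  using assms by (metis M.add.inv_closed M.add.inv_solve_right' M.l_zero M.minus_eq M.zero_closed)

lemma Hom_mod_diff:
  assumes "module k M" "module k N" "f \<in> Hom_mod k M N" "x \<in> carrier M" "y \<in> carrier M"
  shows "f (x \<ominus>\<^bsub>M\<^esub> y) = f x \<ominus>\<^bsub>N\<^esub> f y"
proof -
  interpret M: module k M by fact
  interpret N: module k N by fact
  show ?thesis
    using assms(4,5) Hom_mod_closed[OF assms(3)]
    by (simp add: M.minus_eq N.minus_eq M.a_inv_eq_smult N.a_inv_eq_smult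
        Hom_mod_add[OF assms(3)] Hom_mod_smult[OF assms(3)])
qed

lemma (in module) submodule_by_smult:
  assumes "H \<subseteq> carrier M" "\<zero>\<^bsub>M\<^esub> \<in> H"
    and "\<And>x y. \<lbrakk>x \<in> H; y \<in> H\<rbrakk> \<Longrightarrow> x \<oplus>\<^bsub>M\<^esub> y \<in> H"
    and "\<And>r x. \<lbrakk>r \<in> carrier R; x \<in> H\<rbrakk> \<Longrightarrow> r \<odot>\<^bsub>M\<^esub> x \<in> H"
  shows "submodule H R M"
  using assms by (intro submoduleI) (auto simp: a_inv_eq_smult subset_iff)

lemma equalizer_submodule:
  assumes "module k M" "module k N" "f \<in> Hom_mod k M N" "g \<in> Hom_mod k M N"
  shows "submodule {x \<in> carrier M. f x = g x} k M"
proof -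
  interpret M: module k M by fact
  show ?thesis
    by (rule M.submodule_by_smult)
      (use assms in \<open>auto simp: Hom_mod_zero Hom_mod_add Hom_mod_smult\<close>)
qed

lemma kernel_submodule:
  assumes "module k M" "module k N" "f \<in> Hom_mod k M N"
  shows "submodule {x \<in> carrier M. f x = \<zero>\<^bsub>N\<^esub>} k M"
proof -
  interpret M: module k M by fact
  interpret N: module k N by fact
  show ?thesis
    by (rule M.submodule_by_smult)
      (use assms in \<open>auto simp: Hom_mod_zero Hom_mod_add Hom_mod_smult\<close>)
qed

lemma Hom_mod_eqI:
  assumes "f \<in> Hom_mod k M N" "g \<in> Hom_mod k M N" "\<And>x. x \<in> carrier M \<Longrightarrow> f x = g x"
  shows "f = g"
  using assms unfolding Hom_mod_def by (auto intro: PiE_ext)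

lemma (in module) gen_submodule_submodule:
  assumes "S \<subseteq> carrier M"
  shows "submodule (gen_submodule R M S) R M"
  unfolding gen_submodule_def
proof (rule submodule_by_smult)
  show "\<Inter> {H. submodule H R M \<and> S \<subseteq> H} \<subseteq> carrier M"
    using assms carrier_is_submodule by blast
qed (auto simp: submodule_zero submoduleE(5) submoduleE(4))

lemma gen_submodule_superset: "S \<subseteq> gen_submodule k M S"
  by (auto simp: gen_submodule_def)

lemma gen_submodule_least: "submodule H k M \<Longrightarrow> S \<subseteq> H \<Longrightarrow> gen_submodule k M S \<subseteq> H"
  by (auto simp: gen_submodule_def)

lemma (in module) lincomb_Hom_mod:
  assumes "g \<in> X \<rightarrow> carrier M"
  shows "(\<lambda>c \<in> carrier (free_mod R X). lincomb R M c g) \<in> Hom_mod R (free_mod R X) M"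
  using assms
  by (auto simp: Hom_mod_def lincomb_closed lincomb_add lincomb_smult R.free_mod_closed
      R.free_mod_smult_closed)

text \<open>
Together with \<open>lincomb_Hom_mod\<close> and \<open>lincomb_free_gen\<close> this is the universal property of the free
module.
\<close>

lemma free_mod_Hom_mod_eq:
  assumes N: "module k N"
    and f: "f \<in> Hom_mod k (free_mod k X) N" and g: "g \<in> Hom_mod k (free_mod k X) N"
    and eq: "\<And>x. x \<in> X \<Longrightarrow> f (free_gen k x) = g (free_gen k x)"
  shows "f = g"
proof (rule Hom_mod_eqI[OF f g])
  interpret N: module k N by fact
  interpret F: module k "free_mod k X" by (rule N.R.free_mod_module)
  fix c assume c: "c \<in> carrier (free_mod k X)"
  have "lincomb k (free_mod k X) c (free_gen k) \<in> {c \<in> carrier (free_mod k X). f c = g c}"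
    by (rule F.submodule_lincomb[OF equalizer_submodule[OF F.module_axioms N f g] c])
      (auto simp: eq N.R.free_gen_closed)
  then show "f c = g c"
    using N.R.lincomb_free_gens[OF c] by simp
qed

section \<open>Quotient modules\<close>

lemma (in module) submodule_abelian_subgroup:
  assumes "submodule H R M"
  shows "abelian_subgroup H M"
  by (intro abelian_subgroupI3 additive_subgroupI submodule.axioms(1)[OF assms]
      M.abelian_group_axioms)

lemma (in module) coset_eq_iff:
  assumes H: "submodule H R M" and x: "x \<in> carrier M" and y: "y \<in> carrier M"
  shows "H +>\<^bsub>M\<^esub> x = H +>\<^bsub>M\<^esub> y \<longleftrightarrow> x \<ominus>\<^bsub>M\<^esub> y \<in> H"
proof -
  interpret abelian_subgroup H M by (rule submodule_abelian_subgroup[OF H])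
  have "H +>\<^bsub>M\<^esub> x = H +>\<^bsub>M\<^esub> y \<longleftrightarrow> x \<in> H +>\<^bsub>M\<^esub> y"
    using a_repr_independence'[of x y] a_repr_independenceD[of x y] x y by blast
  also have "\<dots> \<longleftrightarrow> x \<ominus>\<^bsub>M\<^esub> y \<in> H"
    using a_rcos_module[OF y x] by (simp add: M.minus_eq)
  finally show ?thesis .
qed

lemma quot_mod_carrier: "carrier (quot_mod M H) = (\<lambda>x. H +>\<^bsub>M\<^esub> x) ` carrier M"
  by (auto simp: quot_mod_def A_RCOSETS_def')

lemma (in module) quot_mod_add:
  assumes "submodule H R M" "x \<in> carrier M" "y \<in> carrier M"
  shows "(H +>\<^bsub>M\<^esub> x) \<oplus>\<^bsub>quot_mod M H\<^esub> (H +>\<^bsub>M\<^esub> y) = H +>\<^bsub>M\<^esub> (x \<oplus>\<^bsub>M\<^esub> y)"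
  using abelian_subgroup.a_rcos_sum[OF submodule_abelian_subgroup] assms
  by (simp add: quot_mod_def)

text \<open>
The union that defines scalar multiplication of cosets runs over equal sets.
\<close>

lemma (in module) quot_mod_smult:
  assumes H: "submodule H R M" and r: "r \<in> carrier R" and x: "x \<in> carrier M"
  shows "r \<odot>\<^bsub>quot_mod M H\<^esub> (H +>\<^bsub>M\<^esub> x) = H +>\<^bsub>M\<^esub> (r \<odot>\<^bsub>M\<^esub> x)"
proof -
  interpret abelian_subgroup H M by (rule submodule_abelian_subgroup[OF H])
  have *: "H +>\<^bsub>M\<^esub> (r \<odot>\<^bsub>M\<^esub> y) = H +>\<^bsub>M\<^esub> (r \<odot>\<^bsub>M\<^esub> x)" if y: "y \<in> H +>\<^bsub>M\<^esub> x" for y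
  proof -
    have yM: "y \<in> carrier M"
      using a_elemrcos_carrier[OF x y] .
    have "r \<odot>\<^bsub>M\<^esub> (y \<ominus>\<^bsub>M\<^esub> x) \<in> H"
      using a_rcos_module[OF x yM] y submoduleE(4)[OF H r] by (simp add: M.minus_eq)
    moreover have "r \<odot>\<^bsub>M\<^esub> (y \<ominus>\<^bsub>M\<^esub> x) = r \<odot>\<^bsub>M\<^esub> y \<ominus>\<^bsub>M\<^esub> r \<odot>\<^bsub>M\<^esub> x"
      using r x yM by (simp add: M.minus_eq smult_r_distr smult_r_minus)
    ultimately show ?thesis
      using coset_eq_iff[OF H] r x yM by simp
  qed
  show ?thesis
    unfolding quot_mod_def module.simps
    by (rule UN_constant_eq[OF a_rcos_self[OF x]]) (rule ballI, rule *)
qed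

lemma (in module) Hom_mod_quot_pullback:
  assumes H: "submodule H R M" and f: "f \<in> Hom_mod R (quot_mod M H) N"
  shows "(\<lambda>x \<in> carrier M. f (H +>\<^bsub>M\<^esub> x)) \<in> Hom_mod R M N"
proof -
  have Q: "H +>\<^bsub>M\<^esub> x \<in> carrier (quot_mod M H)" if "x \<in> carrier M" for x
    using that by (auto simp: quot_mod_carrier)
  show ?thesis
    using Hom_mod_closed[OF f] Hom_mod_add[OF f] Hom_mod_smult[OF f] Q
    unfolding Hom_mod_def
    by (auto simp: quot_mod_add[OF H, symmetric] quot_mod_smult[OF H, symmetric])
qed

lemma (in module) Hom_mod_quot_lift:
  assumes N: "module R N" and H: "submodule H R M" and f: "f \<in> Hom_mod R M N"
    and zero: "\<And>x. x \<in> H \<Longrightarrow> f x = \<zero>\<^bsub>N\<^esub>"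
  obtains g where "g \<in> Hom_mod R (quot_mod M H) N"
    and "\<And>x. x \<in> carrier M \<Longrightarrow> g (H +>\<^bsub>M\<^esub> x) = f x"
proof -
  interpret N: module R N by fact
  define g where "g = (\<lambda>C \<in> carrier (quot_mod M H). f (SOME x. x \<in> carrier M \<and> C = H +>\<^bsub>M\<^esub> x))"
  have Q: "H +>\<^bsub>M\<^esub> x \<in> carrier (quot_mod M H)" if "x \<in> carrier M" for x
    using that by (auto simp: quot_mod_carrier)
  have g: "g (H +>\<^bsub>M\<^esub> x) = f x" if x: "x \<in> carrier M" for x
  proof -
    define y where "y = (SOME y. y \<in> carrier M \<and> H +>\<^bsub>M\<^esub> x = H +>\<^bsub>M\<^esub> y)"
    have y: "y \<in> carrier M \<and> H +>\<^bsub>M\<^esub> x = H +>\<^bsub>M\<^esub> y"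
      unfolding y_def by (rule someI[of _ x]) (use x in simp)
    then have "f (x \<ominus>\<^bsub>M\<^esub> y) = \<zero>\<^bsub>N\<^esub>"
      using coset_eq_iff[OF H x, of y] zero by blast
    then have "f x = f y"
      using Hom_mod_diff[OF module_axioms N f] x y Hom_mod_closed[OF f]
      by (metis N.minus_eq_zero_iff)
    then show ?thesis
      using Q[OF x] by (simp add: g_def y_def)
  qed
  moreover have "g \<in> Hom_mod R (quot_mod M H) N"
    unfolding Hom_mod_def
    using Hom_mod_closed[OF f] Hom_mod_add[OF f] Hom_mod_smult[OF f]
    by (auto simp: quot_mod_carrier quot_mod_add[OF H] quot_mod_smult[OF H] g)
       (auto simp: g_def quot_mod_carrier)
  ultimately show ?thesis
    using that by blast
qed

section \<open>The universal property of tensor powers\<close>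

text \<open>
\<open>m\<close> is additive and homogeneous in each of its \<open>n\<close> arguments, which are gathered in a list. Nothing
is required of \<open>m\<close> on other lists. For \<open>n = 0\<close> only the value at the empty list has to lie in \<open>N\<close>.
\<close>

definition multilinear ::
  "('r, 'm) ring_scheme \<Rightarrow> ('r, 'a, 'n) module_scheme \<Rightarrow> ('r, 'b, 'o) module_scheme \<Rightarrow> nat
    \<Rightarrow> ('a list \<Rightarrow> 'b) \<Rightarrow> bool"
  where "multilinear k A N n m \<longleftrightarrow>
    m \<in> tuples n (carrier A) \<rightarrow> carrier N \<and>
    (\<forall>us x y vs. us @ x # vs \<in> tuples n (carrier A) \<and> y \<in> carrier A \<longrightarrow>
       m (us @ (x \<oplus>\<^bsub>A\<^esub> y) # vs) = m (us @ x # vs) \<oplus>\<^bsub>N\<^esub> m (us @ y # vs)) \<and>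
    (\<forall>us r x vs. us @ x # vs \<in> tuples n (carrier A) \<and> r \<in> carrier k \<longrightarrow>
       m (us @ (r \<odot>\<^bsub>A\<^esub> x) # vs) = r \<odot>\<^bsub>N\<^esub> m (us @ x # vs))"

lemma tuples_append_Cons:
  "us @ x # vs \<in> tuples n S \<longleftrightarrow>
    set us \<subseteq> S \<and> x \<in> S \<and> set vs \<subseteq> S \<and> length us + Suc (length vs) = n"
  by (auto simp: tuples_def)

lemma tuples_replace: "us @ x # vs \<in> tuples n S \<Longrightarrow> y \<in> S \<Longrightarrow> us @ y # vs \<in> tuples n S"
  by (auto simp: tuples_append_Cons)

lemma (in module) tensor_relations_closed:
  "tensor_relations R M n \<subseteq> carrier (free_mod R (tuples n (carrier M)))"
proof -
  interpret F: module R "free_mod R (tuples n (carrier M))" by (rule R.free_mod_module)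
  show ?thesis
    unfolding tensor_relations_def Let_def
    by (auto simp del: free_mod_simps intro!: F.M.minus_closed F.M.a_closed F.smult_closed
        R.free_gen_closed; auto simp: tuples_append_Cons)
qed

lemma (in module) tensor_kernel_submodule:
  "submodule (tensor_kernel R M n) R (free_mod R (tuples n (carrier M)))"
  unfolding tensor_kernel_def
  by (rule module.gen_submodule_submodule[OF R.free_mod_module tensor_relations_closed])

lemma (in module) tensor_lift:
  assumes N: "module R N" and m: "multilinear R M N n m"
  obtains f where "f \<in> Hom_mod R (tensor_power R M n) N"
    and "\<And>xs. xs \<in> tuples n (carrier M) \<Longrightarrow> f (pure_tensor R M xs) = m xs"
proof -
  interpret N: module R N by fact
  let ?X = "tuples n (carrier M)"
  let ?F = "free_mod R ?X"
  interpret F: module R ?F by (rule R.free_mod_module)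
  define g where "g = (\<lambda>c \<in> carrier ?F. lincomb R N c m)"
  have mX: "m \<in> ?X \<rightarrow> carrier N"
    using m by (simp add: multilinear_def)
  have g: "g \<in> Hom_mod R ?F N"
    unfolding g_def by (rule N.lincomb_Hom_mod[OF mX])
  have g_gen: "g (free_gen R xs) = m xs" if "xs \<in> ?X" for xs
    using that by (simp add: g_def R.free_gen_closed N.lincomb_free_gen[OF that mX])
  have "g c = \<zero>\<^bsub>N\<^esub>" if "c \<in> tensor_relations R M n" for c
  proof -
    note * = Hom_mod_diff[OF F.module_axioms N g] Hom_mod_add[OF g] Hom_mod_smult[OF g]
      R.free_gen_closed F.M.a_closed F.smult_closed g_gen
    from that consider us x y vs where "us @ x # vs \<in> ?X" "y \<in> carrier M"
        "c = free_gen R (us @ (x \<oplus>\<^bsub>M\<^esub> y) # vs) \<ominus>\<^bsub>?F\<^esub>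
          (free_gen R (us @ x # vs) \<oplus>\<^bsub>?F\<^esub> free_gen R (us @ y # vs))"
      | us r x vs where "us @ x # vs \<in> ?X" "r \<in> carrier R"
        "c = free_gen R (us @ (r \<odot>\<^bsub>M\<^esub> x) # vs) \<ominus>\<^bsub>?F\<^esub> r \<odot>\<^bsub>?F\<^esub> free_gen R (us @ x # vs)"
      unfolding tensor_relations_def Let_def by blast
    then show ?thesis
    proof cases
      case 1
      then have X: "us @ (x \<oplus>\<^bsub>M\<^esub> y) # vs \<in> ?X" "us @ y # vs \<in> ?X"
        by (auto simp: tuples_append_Cons)
      have "g c = m (us @ (x \<oplus>\<^bsub>M\<^esub> y) # vs) \<ominus>\<^bsub>N\<^esub> (m (us @ x # vs) \<oplus>\<^bsub>N\<^esub> m (us @ y # vs))"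
        using 1 X by (simp add: * del: free_mod_simps)
      also have "\<dots> = \<zero>\<^bsub>N\<^esub>"
        using m 1 X mX by (auto simp: multilinear_def Pi_iff N.minus_eq_zero_iff)
      finally show ?thesis .
    next
      case 2
      then have X: "us @ (r \<odot>\<^bsub>M\<^esub> x) # vs \<in> ?X"
        by (auto simp: tuples_append_Cons)
      have "g c = m (us @ (r \<odot>\<^bsub>M\<^esub> x) # vs) \<ominus>\<^bsub>N\<^esub> r \<odot>\<^bsub>N\<^esub> m (us @ x # vs)"
        using 2 X by (simp add: * del: free_mod_simps)
      also have "\<dots> = \<zero>\<^bsub>N\<^esub>"
        using m 2 X mX by (auto simp: multilinear_def Pi_iff N.minus_eq_zero_iff)
      finally show ?thesis .
    qed
  qed
  then have "tensor_kernel R M n \<subseteq> {c \<in> carrier ?F. g c = \<zero>\<^bsub>N\<^esub>}"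
    unfolding tensor_kernel_def
    using tensor_relations_closed
    by (intro gen_submodule_least kernel_submodule[OF F.module_axioms N g]) auto
  then obtain f where f: "f \<in> Hom_mod R (tensor_power R M n) N"
    "\<And>c. c \<in> carrier ?F \<Longrightarrow> f (tensor_kernel R M n +>\<^bsub>?F\<^esub> c) = g c"
    using F.Hom_mod_quot_lift[OF N tensor_kernel_submodule g]
    unfolding tensor_power_def by blast
  show ?thesis
  proof (rule that[OF f(1)])
    fix xs assume xs: "xs \<in> ?X"
    then show "f (pure_tensor R M xs) = m xs"
      using f(2)[OF R.free_gen_closed[OF xs]] g_gen by (auto simp: pure_tensor_def tuples_def)
  qed
qed

lemma (in module) pure_tensor_closed:
  assumes "xs \<in> tuples n (carrier M)"
  shows "pure_tensor R M xs \<in> carrier (tensor_power R M n)"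
  using assms R.free_gen_closed[OF assms]
  by (auto simp: tensor_power_def quot_mod_carrier pure_tensor_def tuples_def)

lemma (in module) tensor_Hom_mod_eq:
  assumes N: "module R N"
    and f: "f \<in> Hom_mod R (tensor_power R M n) N" and g: "g \<in> Hom_mod R (tensor_power R M n) N"
    and eq: "\<And>xs. xs \<in> tuples n (carrier M) \<Longrightarrow> f (pure_tensor R M xs) = g (pure_tensor R M xs)"
  shows "f = g"
proof (rule Hom_mod_eqI[OF f g])
  let ?X = "tuples n (carrier M)"
  let ?F = "free_mod R ?X"
  let ?K = "tensor_kernel R M n"
  interpret F: module R ?F by (rule R.free_mod_module)
  note pull = F.Hom_mod_quot_pullback[OF tensor_kernel_submodule, folded tensor_power_def]
  have *: "(\<lambda>c \<in> carrier ?F. f (?K +>\<^bsub>?F\<^esub> c)) = (\<lambda>c \<in> carrier ?F. g (?K +>\<^bsub>?F\<^esub> c))"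
  proof (rule free_mod_Hom_mod_eq[OF N pull[OF f] pull[OF g]])
    fix xs assume xs: "xs \<in> ?X"
    then have "?K +>\<^bsub>?F\<^esub> free_gen R xs = pure_tensor R M xs"
      by (auto simp: pure_tensor_def tuples_def)
    then show "(\<lambda>c \<in> carrier ?F. f (?K +>\<^bsub>?F\<^esub> c)) (free_gen R xs)
        = (\<lambda>c \<in> carrier ?F. g (?K +>\<^bsub>?F\<^esub> c)) (free_gen R xs)"
      using eq[OF xs] R.free_gen_closed[OF xs] by simp
  qed
  fix t assume "t \<in> carrier (tensor_power R M n)"
  then obtain c where "c \<in> carrier ?F" "t = ?K +>\<^bsub>?F\<^esub> c"
    by (auto simp: tensor_power_def quot_mod_carrier)
  then show "f t = g t"
    using fun_cong[OF *, of c] by simp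
qed

lemma (in module) pure_tensor_add:
  assumes "us @ x # vs \<in> tuples n (carrier M)" "y \<in> carrier M"
  shows "pure_tensor R M (us @ (x \<oplus>\<^bsub>M\<^esub> y) # vs)
    = pure_tensor R M (us @ x # vs) \<oplus>\<^bsub>tensor_power R M n\<^esub> pure_tensor R M (us @ y # vs)"
proof -
  let ?X = "tuples n (carrier M)"
  let ?F = "free_mod R ?X"
  let ?K = "tensor_kernel R M n"
  interpret F: module R ?F by (rule R.free_mod_module)
  have X: "us @ (x \<oplus>\<^bsub>M\<^esub> y) # vs \<in> ?X" "us @ y # vs \<in> ?X"
    using assms by (auto simp: tuples_append_Cons)
  have "free_gen R (us @ (x \<oplus>\<^bsub>M\<^esub> y) # vs) \<ominus>\<^bsub>?F\<^esub>
      (free_gen R (us @ x # vs) \<oplus>\<^bsub>?F\<^esub> free_gen R (us @ y # vs)) \<in> tensor_relations R M n"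
    unfolding tensor_relations_def Let_def using assms by blast
  then have "?K +>\<^bsub>?F\<^esub> free_gen R (us @ (x \<oplus>\<^bsub>M\<^esub> y) # vs)
      = ?K +>\<^bsub>?F\<^esub> (free_gen R (us @ x # vs) \<oplus>\<^bsub>?F\<^esub> free_gen R (us @ y # vs))"
    using X assms gen_submodule_superset[of "tensor_relations R M n"]
    by (subst F.coset_eq_iff[OF tensor_kernel_submodule])
      (auto simp: tensor_kernel_def R.free_gen_closed simp del: free_mod_simps intro!: F.M.a_closed)
  also have "\<dots> = (?K +>\<^bsub>?F\<^esub> free_gen R (us @ x # vs)) \<oplus>\<^bsub>tensor_power R M n\<^esub>
      (?K +>\<^bsub>?F\<^esub> free_gen R (us @ y # vs))"
    unfolding tensor_power_def using X assms
    by (intro F.quot_mod_add[OF tensor_kernel_submodule, symmetric] R.free_gen_closed)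
  finally show ?thesis
    using assms by (simp add: pure_tensor_def tuples_append_Cons)
qed

lemma (in module) pure_tensor_smult:
  assumes "us @ x # vs \<in> tuples n (carrier M)" "r \<in> carrier R"
  shows "pure_tensor R M (us @ (r \<odot>\<^bsub>M\<^esub> x) # vs)
    = r \<odot>\<^bsub>tensor_power R M n\<^esub> pure_tensor R M (us @ x # vs)"
proof -
  let ?X = "tuples n (carrier M)"
  let ?F = "free_mod R ?X"
  let ?K = "tensor_kernel R M n"
  interpret F: module R ?F by (rule R.free_mod_module)
  have X: "us @ (r \<odot>\<^bsub>M\<^esub> x) # vs \<in> ?X"
    using assms by (auto simp: tuples_append_Cons)
  have "free_gen R (us @ (r \<odot>\<^bsub>M\<^esub> x) # vs) \<ominus>\<^bsub>?F\<^esub> r \<odot>\<^bsub>?F\<^esub> free_gen R (us @ x # vs)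
      \<in> tensor_relations R M n"
    unfolding tensor_relations_def Let_def using assms by blast
  then have "?K +>\<^bsub>?F\<^esub> free_gen R (us @ (r \<odot>\<^bsub>M\<^esub> x) # vs)
      = ?K +>\<^bsub>?F\<^esub> (r \<odot>\<^bsub>?F\<^esub> free_gen R (us @ x # vs))"
    using X assms gen_submodule_superset[of "tensor_relations R M n"]
    by (subst F.coset_eq_iff[OF tensor_kernel_submodule])
      (auto simp: tensor_kernel_def R.free_gen_closed simp del: free_mod_simps
        intro!: F.smult_closed)
  also have "\<dots> = r \<odot>\<^bsub>tensor_power R M n\<^esub> (?K +>\<^bsub>?F\<^esub> free_gen R (us @ x # vs))"
    unfolding tensor_power_def using X assms
    by (intro F.quot_mod_smult[OF tensor_kernel_submodule, symmetric] R.free_gen_closed)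
  finally show ?thesis
    using assms by (simp add: pure_tensor_def tuples_append_Cons)
qed

lemma (in module) Hom_mod_multilinear:
  assumes f: "f \<in> Hom_mod R (tensor_power R M n) N"
  shows "multilinear R M N n (\<lambda>xs. f (pure_tensor R M xs))"
  unfolding multilinear_def
proof (intro conjI allI impI funcsetI; (elim conjE)?)
  fix us x y vs assume *: "us @ x # vs \<in> tuples n (carrier M)" "y \<in> carrier M"
  then have "us @ y # vs \<in> tuples n (carrier M)"
    by (simp add: tuples_append_Cons)
  then show "f (pure_tensor R M (us @ (x \<oplus>\<^bsub>M\<^esub> y) # vs))
      = f (pure_tensor R M (us @ x # vs)) \<oplus>\<^bsub>N\<^esub> f (pure_tensor R M (us @ y # vs))"
    using * by (simp add: pure_tensor_add Hom_mod_add[OF f] pure_tensor_closed)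
qed (auto simp: pure_tensor_smult Hom_mod_smult[OF f] pure_tensor_closed
      intro: Hom_mod_closed[OF f])

section \<open>Coordinates and maps given on basis tensors\<close>

text \<open>
The coefficients of \<open>a\<close> in the basis \<open>\<phi>\<close>, unique by the definition of a free basis.
\<close>

definition coord ::
  "('r, 'm) ring_scheme \<Rightarrow> ('r, 'a, 'n) module_scheme \<Rightarrow> 'i set \<Rightarrow> ('i \<Rightarrow> 'a) \<Rightarrow> 'a \<Rightarrow> 'i \<Rightarrow> 'r"
  where "coord k A \<Omega> \<phi> a = (THE c. c \<in> carrier (free_mod k \<Omega>) \<and> a = lincomb k A c \<phi>)"

text \<open>
The value at \<open>xs\<close> of the multilinear map that agrees with \<open>h\<close> on tuples of basis elements: each
entry of \<open>xs\<close> is expanded in the basis, one entry after the other, which avoids sums over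
multi-indices.
\<close>

primrec multilinear_extension ::
  "('r, 'm) ring_scheme \<Rightarrow> ('r, 'a, 'n) module_scheme \<Rightarrow> ('r, 'b, 'o) module_scheme
    \<Rightarrow> 'i set \<Rightarrow> ('i \<Rightarrow> 'a) \<Rightarrow> 'a list \<Rightarrow> ('a list \<Rightarrow> 'b) \<Rightarrow> 'b"
  where
    "multilinear_extension k A N \<Omega> \<phi> [] h = h []"
  | "multilinear_extension k A N \<Omega> \<phi> (x # xs) h =
      lincomb k N (coord k A \<Omega> \<phi> x)
        (\<lambda>i. multilinear_extension k A N \<Omega> \<phi> xs (\<lambda>bs. h (\<phi> i # bs)))"

context module
begin

lemma free_basis_iff:
  "free_basis R M \<Omega> \<phi> \<longleftrightarrow> \<phi> \<in> \<Omega> \<rightarrow> carrier M \<and>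
    (\<forall>a \<in> carrier M. \<exists>!c. c \<in> carrier (free_mod R \<Omega>) \<and> a = lincomb R M c \<phi>)"
proof -
  have "{\<omega> \<in> \<Omega>. c \<omega> \<noteq> \<zero>} = {\<omega>. c \<omega> \<noteq> \<zero>}" if "c \<in> carrier (free_mod R \<Omega>)" for c
    using free_mod_support(2)[OF that] by auto
  then show ?thesis
    unfolding free_basis_def lincomb_def by (simp cong: conj_cong)
qed

context
  fixes \<Omega> :: "'i set" and \<phi> :: "'i \<Rightarrow> 'c"
  assumes basis: "free_basis R M \<Omega> \<phi>"
begin

lemma basis_closed: "\<phi> \<in> \<Omega> \<rightarrow> carrier M"
  using basis by (simp add: free_basis_iff)

lemma
  assumes "a \<in> carrier M"
  shows coord_closed: "coord R M \<Omega> \<phi> a \<in> carrier (free_mod R \<Omega>)"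
    and lincomb_coord: "lincomb R M (coord R M \<Omega> \<phi> a) \<phi> = a"
proof -
  have "\<exists>!c. c \<in> carrier (free_mod R \<Omega>) \<and> a = lincomb R M c \<phi>"
    using basis assms by (simp add: free_basis_iff)
  from theI'[OF this]
  show "coord R M \<Omega> \<phi> a \<in> carrier (free_mod R \<Omega>)" "lincomb R M (coord R M \<Omega> \<phi> a) \<phi> = a"
    by (simp_all add: coord_def)
qed

lemma coord_lincomb:
  assumes c: "c \<in> carrier (free_mod R \<Omega>)"
  shows "coord R M \<Omega> \<phi> (lincomb R M c \<phi>) = c"
proof -
  have a: "lincomb R M c \<phi> \<in> carrier M"
    by (rule lincomb_closed[OF c basis_closed])
  then have "\<exists>!d. d \<in> carrier (free_mod R \<Omega>) \<and> lincomb R M c \<phi> = lincomb R M d \<phi>"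
    using basis by (simp add: free_basis_iff)
  then show ?thesis
    using coord_closed[OF a] lincomb_coord[OF a] c by metis
qed

text \<open>
This also covers the zero ring, over which \<open>\<phi>\<close> need not be injective.
\<close>

lemma coord_basis: "i \<in> \<Omega> \<Longrightarrow> coord R M \<Omega> \<phi> (\<phi> i) = free_gen R i"
  using coord_lincomb[OF R.free_gen_closed] lincomb_free_gen[OF _ basis_closed] by metis

lemma coord_add:
  assumes "a \<in> carrier M" "b \<in> carrier M"
  shows "coord R M \<Omega> \<phi> (a \<oplus>\<^bsub>M\<^esub> b) = (\<lambda>i. coord R M \<Omega> \<phi> a i \<oplus> coord R M \<Omega> \<phi> b i)"
  using coord_lincomb[OF R.free_mod_closed[OF coord_closed[OF assms(1)] coord_closed[OF assms(2)]]]
  by (simp add: lincomb_add[OF coord_closed[OF assms(1)] coord_closed[OF assms(2)] basis_closed]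
      lincomb_coord assms)

lemma coord_smult:
  assumes "r \<in> carrier R" "a \<in> carrier M"
  shows "coord R M \<Omega> \<phi> (r \<odot>\<^bsub>M\<^esub> a) = (\<lambda>i. r \<otimes> coord R M \<Omega> \<phi> a i)"
  using coord_lincomb[OF R.free_mod_smult_closed[OF assms(1) coord_closed[OF assms(2)]]]
  by (simp add: lincomb_smult[OF assms(1) coord_closed[OF assms(2)] basis_closed] lincomb_coord assms)

lemma submodule_containing_basis:
  assumes "submodule H R M" "\<phi> ` \<Omega> \<subseteq> H"
  shows "carrier M \<subseteq> H"
proof
  fix a assume "a \<in> carrier M"
  then show "a \<in> H"
    using submodule_lincomb[OF assms(1) coord_closed, of a \<phi>] assms(2) lincomb_coord by auto
qed

text \<open>
The arguments are freed from the basis one at a time, from right to left: for a fixed slot, the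
elements at which both maps agree form a submodule that contains the basis.
\<close>

lemma multilinear_eq_on_basis:
  assumes N: "module R N" and f: "multilinear R M N n f" and g: "multilinear R M N n g"
    and eq: "\<And>bs. bs \<in> tuples n (\<phi> ` \<Omega>) \<Longrightarrow> f bs = g bs"
    and xs: "xs \<in> tuples n (carrier M)"
  shows "f xs = g xs"
proof -
  interpret N: module R N by fact
  have B: "\<phi> ` \<Omega> \<subseteq> carrier M"
    using basis_closed by auto
  \<comment> \<open>The first entries \<open>us\<close> are basis elements, the remaining \<open>vs\<close> are arbitrary.\<close>
  have "f (us @ vs) = g (us @ vs)"
    if "set us \<subseteq> \<phi> ` \<Omega>" "set vs \<subseteq> carrier M" "length us + length vs = n" for us vs
    using that
  proof (induction vs arbitrary: us)
    case Nil
    then show ?case using eq[of us] by (simp add: tuples_def)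
  next
    case (Cons v vs)
    define H where "H = {x \<in> carrier M. f (us @ x # vs) = g (us @ x # vs)}"
    have T: "us @ x # vs \<in> tuples n (carrier M)" if "x \<in> carrier M" for x
      using Cons.prems that B by (auto simp: tuples_append_Cons)
    have add: "f (us @ (x \<oplus>\<^bsub>M\<^esub> y) # vs) = f (us @ x # vs) \<oplus>\<^bsub>N\<^esub> f (us @ y # vs)"
      "g (us @ (x \<oplus>\<^bsub>M\<^esub> y) # vs) = g (us @ x # vs) \<oplus>\<^bsub>N\<^esub> g (us @ y # vs)"
      if "x \<in> carrier M" "y \<in> carrier M" for x y
      using f g T[OF that(1)] that(2) by (auto simp: multilinear_def)
    have smult: "f (us @ (r \<odot>\<^bsub>M\<^esub> x) # vs) = r \<odot>\<^bsub>N\<^esub> f (us @ x # vs)"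
      "g (us @ (r \<odot>\<^bsub>M\<^esub> x) # vs) = r \<odot>\<^bsub>N\<^esub> g (us @ x # vs)"
      if "r \<in> carrier R" "x \<in> carrier M" for r x
      using f g T[OF that(2)] that(1) by (auto simp: multilinear_def)
    have closed: "f (us @ x # vs) \<in> carrier N" "g (us @ x # vs) \<in> carrier N"
      if "x \<in> carrier M" for x
      using f g T[OF that] by (auto simp: multilinear_def)
    have "f (us @ \<zero>\<^bsub>M\<^esub> # vs) = g (us @ \<zero>\<^bsub>M\<^esub> # vs)"
      using smult[of \<zero> "\<zero>\<^bsub>M\<^esub>"] closed[of "\<zero>\<^bsub>M\<^esub>"] by simp
    then have "submodule H R M"
      by (intro submodule_by_smult) (auto simp: H_def add smult)
    moreover have "\<phi> ` \<Omega> \<subseteq> H"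
    proof
      fix b assume "b \<in> \<phi> ` \<Omega>"
      then show "b \<in> H"
        using Cons.IH[of "us @ [b]"] Cons.prems B by (auto simp: H_def)
    qed
    ultimately have "carrier M \<subseteq> H"
      by (rule submodule_containing_basis)
    then show ?case
      using Cons.prems(2) by (auto simp: H_def)
  qed
  from this[of "[]" xs] xs show ?thesis
    by (simp add: tuples_def)
qed


end

context
  fixes \<Omega> :: "'i set" and \<phi> :: "'i \<Rightarrow> 'c" and N :: "('a, 'e, 'f) module_scheme"
  assumes basis: "free_basis R M \<Omega> \<phi>" and N: "module R N"
begin

lemma multilinear_extension_closed:
  assumes "set xs \<subseteq> carrier M" "h \<in> tuples (length xs) (\<phi> ` \<Omega>) \<rightarrow> carrier N"
  shows "multilinear_extension R M N \<Omega> \<phi> xs h \<in> carrier N"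
  using assms
proof (induction xs arbitrary: h)
  case Nil
  then show ?case by (auto simp: tuples_def)
next
  case (Cons x xs)
  have "(\<lambda>bs. h (\<phi> i # bs)) \<in> tuples (length xs) (\<phi> ` \<Omega>) \<rightarrow> carrier N" if "i \<in> \<Omega>" for i
    using Cons.prems(2) that by (auto simp: tuples_def Pi_iff)
  with Cons show ?case
    by (auto intro!: module.lincomb_closed[OF N coord_closed[OF basis]])
qed

lemma multilinear_extension_basis:
  assumes "set bs \<subseteq> \<phi> ` \<Omega>" "h \<in> tuples (length bs) (\<phi> ` \<Omega>) \<rightarrow> carrier N"
  shows "multilinear_extension R M N \<Omega> \<phi> bs h = h bs"
  using assms
proof (induction bs arbitrary: h)
  case Nil
  then show ?case by simp
next
  case (Cons b bs)
  then obtain j where j: "j \<in> \<Omega>" "b = \<phi> j"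
    by auto
  have B: "set bs \<subseteq> carrier M"
    using Cons.prems basis_closed[OF basis] by auto
  have h: "(\<lambda>bs. h (\<phi> i # bs)) \<in> tuples (length bs) (\<phi> ` \<Omega>) \<rightarrow> carrier N" if "i \<in> \<Omega>" for i
    using Cons.prems(2) that by (auto simp: tuples_def Pi_iff)
  have "multilinear_extension R M N \<Omega> \<phi> (b # bs) h
      = multilinear_extension R M N \<Omega> \<phi> bs (\<lambda>bs. h (\<phi> j # bs))"
    using multilinear_extension_closed[OF B h] j
    by (auto simp: coord_basis[OF basis] intro!: module.lincomb_free_gen[OF N])
  also have "\<dots> = h (b # bs)"
    using Cons.IH[OF _ h[OF j(1)]] Cons.prems(1) j(2) by simp
  finally show ?case .
qed

lemma multilinear_extension_add:
  assumes "set us \<subseteq> carrier M" "set vs \<subseteq> carrier M" "x \<in> carrier M" "y \<in> carrier M"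
    and "h \<in> tuples (length us + Suc (length vs)) (\<phi> ` \<Omega>) \<rightarrow> carrier N"
  shows "multilinear_extension R M N \<Omega> \<phi> (us @ (x \<oplus>\<^bsub>M\<^esub> y) # vs) h
    = multilinear_extension R M N \<Omega> \<phi> (us @ x # vs) h
      \<oplus>\<^bsub>N\<^esub> multilinear_extension R M N \<Omega> \<phi> (us @ y # vs) h"
  using assms
proof (induction us arbitrary: h)
  case Nil
  have h: "(\<lambda>bs. h (\<phi> i # bs)) \<in> tuples (length vs) (\<phi> ` \<Omega>) \<rightarrow> carrier N" if "i \<in> \<Omega>" for i
    using Nil that by (auto simp: tuples_def Pi_iff)
  show ?case
    using Nil multilinear_extension_closed[OF _ h]
    by (auto simp: coord_add[OF basis] intro!: module.lincomb_add[OF N] coord_closed[OF basis])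
next
  case (Cons u us)
  have h: "(\<lambda>bs. h (\<phi> i # bs)) \<in> tuples (length us + Suc (length vs)) (\<phi> ` \<Omega>) \<rightarrow> carrier N"
    if "i \<in> \<Omega>" for i
    using Cons.prems(5) that by (auto simp: tuples_def Pi_iff)
  let ?E = "\<lambda>x i. multilinear_extension R M N \<Omega> \<phi> (us @ x # vs) (\<lambda>bs. h (\<phi> i # bs))"
  have u: "coord R M \<Omega> \<phi> u \<in> carrier (free_mod R \<Omega>)"
    using coord_closed[OF basis] Cons.prems(1) by simp
  have E: "?E x \<in> \<Omega> \<rightarrow> carrier N" if "x \<in> carrier M" for x
    using Cons.prems(1,2) that h by (auto simp: Pi_iff intro!: multilinear_extension_closed)
  interpret N: module R N by (rule N)
  have "lincomb R N (coord R M \<Omega> \<phi> u) (?E (x \<oplus>\<^bsub>M\<^esub> y))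
      = lincomb R N (coord R M \<Omega> \<phi> u) (\<lambda>i. ?E x i \<oplus>\<^bsub>N\<^esub> ?E y i)"
    using Cons.IH[OF _ _ _ _ h] Cons.prems E[of x] E[of y]
    by (intro N.lincomb_cong[OF u]) auto
  also have "\<dots> = lincomb R N (coord R M \<Omega> \<phi> u) (?E x) \<oplus>\<^bsub>N\<^esub> lincomb R N (coord R M \<Omega> \<phi> u) (?E y)"
    using Cons.prems by (intro N.lincomb_add_right[OF u] E)
  finally show ?case by simp
qed

lemma multilinear_extension_smult:
  assumes "set us \<subseteq> carrier M" "set vs \<subseteq> carrier M" "x \<in> carrier M" "r \<in> carrier R"
    and "h \<in> tuples (length us + Suc (length vs)) (\<phi> ` \<Omega>) \<rightarrow> carrier N"
  shows "multilinear_extension R M N \<Omega> \<phi> (us @ (r \<odot>\<^bsub>M\<^esub> x) # vs) h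
    = r \<odot>\<^bsub>N\<^esub> multilinear_extension R M N \<Omega> \<phi> (us @ x # vs) h"
  using assms
proof (induction us arbitrary: h)
  case Nil
  have h: "(\<lambda>bs. h (\<phi> i # bs)) \<in> tuples (length vs) (\<phi> ` \<Omega>) \<rightarrow> carrier N" if "i \<in> \<Omega>" for i
    using Nil that by (auto simp: tuples_def Pi_iff)
  show ?case
    using Nil multilinear_extension_closed[OF _ h]
    by (auto simp: coord_smult[OF basis] intro!: module.lincomb_smult[OF N] coord_closed[OF basis])
next
  case (Cons u us)
  have h: "(\<lambda>bs. h (\<phi> i # bs)) \<in> tuples (length us + Suc (length vs)) (\<phi> ` \<Omega>) \<rightarrow> carrier N"
    if "i \<in> \<Omega>" for i
    using Cons.prems(5) that by (auto simp: tuples_def Pi_iff)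
  let ?E = "\<lambda>x i. multilinear_extension R M N \<Omega> \<phi> (us @ x # vs) (\<lambda>bs. h (\<phi> i # bs))"
  have u: "coord R M \<Omega> \<phi> u \<in> carrier (free_mod R \<Omega>)"
    using coord_closed[OF basis] Cons.prems(1) by simp
  have E: "?E x \<in> \<Omega> \<rightarrow> carrier N" if "x \<in> carrier M" for x
    using Cons.prems(1,2) that h by (auto simp: Pi_iff intro!: multilinear_extension_closed)
  interpret N: module R N by (rule N)
  have "lincomb R N (coord R M \<Omega> \<phi> u) (?E (r \<odot>\<^bsub>M\<^esub> x))
      = lincomb R N (coord R M \<Omega> \<phi> u) (\<lambda>i. r \<odot>\<^bsub>N\<^esub> ?E x i)"
    using Cons.IH[OF _ _ _ _ h] Cons.prems E[of x]
    by (intro N.lincomb_cong[OF u]) auto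
  also have "\<dots> = r \<odot>\<^bsub>N\<^esub> lincomb R N (coord R M \<Omega> \<phi> u) (?E x)"
    using Cons.prems by (intro N.lincomb_smult_right[OF u] E)
  finally show ?case by simp
qed

lemma multilinear_extension_multilinear:
  assumes h: "h \<in> tuples n (\<phi> ` \<Omega>) \<rightarrow> carrier N"
  shows "multilinear R M N n (\<lambda>xs. multilinear_extension R M N \<Omega> \<phi> xs h)"
  unfolding multilinear_def
  using h by (auto simp: tuples_append_Cons multilinear_extension_add multilinear_extension_smult)
    (auto simp: tuples_def intro!: multilinear_extension_closed)

text \<open>
The pure tensors of basis elements behave as a basis of the tensor power: every choice of values
on them extends uniquely to a linear map. This makes the maps that are specified on basis
tensors well defined.
\<close>

lemma tensor_Hom_mod_ex1_on_basis:
  assumes h: "h \<in> tuples n (\<phi> ` \<Omega>) \<rightarrow> carrier N"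
  shows "\<exists>!f. f \<in> Hom_mod R (tensor_power R M n) N \<and>
    (\<forall>bs \<in> tuples n (\<phi> ` \<Omega>). f (pure_tensor R M bs) = h bs)"
proof (rule ex_ex1I)
  have B: "bs \<in> tuples n (carrier M)" if "bs \<in> tuples n (\<phi> ` \<Omega>)" for bs
    using that basis_closed[OF basis] by (auto simp: tuples_def)
  obtain f where f: "f \<in> Hom_mod R (tensor_power R M n) N"
    "\<And>xs. xs \<in> tuples n (carrier M) \<Longrightarrow>
      f (pure_tensor R M xs) = multilinear_extension R M N \<Omega> \<phi> xs h"
    by (rule tensor_lift[OF N multilinear_extension_multilinear[OF h]]) blast
  have "f (pure_tensor R M bs) = h bs" if "bs \<in> tuples n (\<phi> ` \<Omega>)" for bs
    using f(2)[OF B[OF that]] multilinear_extension_basis[of bs h] that h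
    by (simp add: tuples_def)
  with f(1) show "\<exists>f. f \<in> Hom_mod R (tensor_power R M n) N \<and>
      (\<forall>bs \<in> tuples n (\<phi> ` \<Omega>). f (pure_tensor R M bs) = h bs)"
    by blast
next
  fix f g
  assume f: "f \<in> Hom_mod R (tensor_power R M n) N \<and>
      (\<forall>bs \<in> tuples n (\<phi> ` \<Omega>). f (pure_tensor R M bs) = h bs)"
    and g: "g \<in> Hom_mod R (tensor_power R M n) N \<and>
      (\<forall>bs \<in> tuples n (\<phi> ` \<Omega>). g (pure_tensor R M bs) = h bs)"
  show "f = g"
  proof (rule tensor_Hom_mod_eq[OF N])
    fix xs assume xs: "xs \<in> tuples n (carrier M)"
    show "f (pure_tensor R M xs) = g (pure_tensor R M xs)"
      by (rule multilinear_eq_on_basis[OF basis N _ _ _ xs])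
        (use f g in \<open>auto intro: Hom_mod_multilinear\<close>)
  qed (use f g in auto)
qed

end

end

section \<open>Products of multilinear maps and of lists\<close>

lemma take_append_Cons:
  "length us < p \<Longrightarrow> take p (us @ x # vs) = us @ x # take (p - Suc (length us)) vs"
  "p \<le> length us \<Longrightarrow> take p (us @ x # vs) = take p us"
  by (auto simp: take_Cons')

lemma drop_append_Cons:
  "length us < p \<Longrightarrow> drop p (us @ x # vs) = drop (p - Suc (length us)) vs"
  "p \<le> length us \<Longrightarrow> drop p (us @ x # vs) = drop p us @ x # vs"
  by (auto simp: drop_Cons')

lemma tuples_take_drop:
  assumes "xs \<in> tuples (p + q) S"
  shows "take p xs \<in> tuples p S" "drop p xs \<in> tuples q S"
  using assms set_take_subset[of p xs] set_drop_subset[of p xs] by (auto simp: tuples_def)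

lemma ball_tuples_add:
  "(\<forall>xs \<in> tuples (p + q) S. P xs) \<longleftrightarrow> (\<forall>us \<in> tuples p S. \<forall>vs \<in> tuples q S. P (us @ vs))"
proof
  assume *: "\<forall>us \<in> tuples p S. \<forall>vs \<in> tuples q S. P (us @ vs)"
  show "\<forall>xs \<in> tuples (p + q) S. P xs"
    using * tuples_take_drop[of _ p q S] append_take_drop_id by metis
qed (auto simp: tuples_def)

text \<open>
Centrality of the scalars, on both sides of the product, is what makes the product homogeneous
in the arguments of both factors.
\<close>

lemma multilinear_mult:
  assumes "unital_algebra k N"
    and f: "multilinear k A N p f" and g: "multilinear k A N q g"
  shows "multilinear k A N (p + q) (\<lambda>xs. f (take p xs) \<otimes>\<^bsub>N\<^esub> g (drop p xs))"
proof -
  interpret N: unital_algebra k N by fact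
  have closed: "f xs \<in> carrier N" if "xs \<in> tuples p (carrier A)" for xs
    using f that by (auto simp: multilinear_def)
  have closed': "g xs \<in> carrier N" if "xs \<in> tuples q (carrier A)" for xs
    using g that by (auto simp: multilinear_def)
  have f_add: "f (us @ (x \<oplus>\<^bsub>A\<^esub> y) # vs) = f (us @ x # vs) \<oplus>\<^bsub>N\<^esub> f (us @ y # vs)"
    if "us @ x # vs \<in> tuples p (carrier A)" "y \<in> carrier A" for us x y vs
    using f that by (auto simp: multilinear_def)
  have g_add: "g (us @ (x \<oplus>\<^bsub>A\<^esub> y) # vs) = g (us @ x # vs) \<oplus>\<^bsub>N\<^esub> g (us @ y # vs)"
    if "us @ x # vs \<in> tuples q (carrier A)" "y \<in> carrier A" for us x y vs
    using g that by (auto simp: multilinear_def)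
  have f_smult: "f (us @ (r \<odot>\<^bsub>A\<^esub> x) # vs) = r \<odot>\<^bsub>N\<^esub> f (us @ x # vs)"
    if "us @ x # vs \<in> tuples p (carrier A)" "r \<in> carrier k" for us r x vs
    using f that by (auto simp: multilinear_def)
  have g_smult: "g (us @ (r \<odot>\<^bsub>A\<^esub> x) # vs) = r \<odot>\<^bsub>N\<^esub> g (us @ x # vs)"
    if "us @ x # vs \<in> tuples q (carrier A)" "r \<in> carrier k" for us r x vs
    using g that by (auto simp: multilinear_def)
  show ?thesis
    unfolding multilinear_def
  proof (intro conjI allI impI funcsetI; (elim conjE)?)
    fix xs assume "xs \<in> tuples (p + q) (carrier A)"
    from tuples_take_drop[OF this]
    show "f (take p xs) \<otimes>\<^bsub>N\<^esub> g (drop p xs) \<in> carrier N"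
      by (simp add: closed closed')
  next
    fix us x y vs assume us: "us @ x # vs \<in> tuples (p + q) (carrier A)" and y: "y \<in> carrier A"
    note T = tuples_take_drop[OF us] tuples_take_drop[OF tuples_replace[OF us y]]
    show "f (take p (us @ (x \<oplus>\<^bsub>A\<^esub> y) # vs)) \<otimes>\<^bsub>N\<^esub> g (drop p (us @ (x \<oplus>\<^bsub>A\<^esub> y) # vs)) =
        f (take p (us @ x # vs)) \<otimes>\<^bsub>N\<^esub> g (drop p (us @ x # vs)) \<oplus>\<^bsub>N\<^esub>
        f (take p (us @ y # vs)) \<otimes>\<^bsub>N\<^esub> g (drop p (us @ y # vs))"
    proof (cases "length us < p")
      case True
      then show ?thesis
        using T y by (simp only: take_append_Cons drop_append_Cons f_add closed closed' N.l_distr)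
    next
      case False
      then have "p \<le> length us" by simp
      then show ?thesis
        using T y by (simp only: take_append_Cons drop_append_Cons g_add closed closed' N.r_distr)
    qed
  next
    fix us r x vs assume us: "us @ x # vs \<in> tuples (p + q) (carrier A)" and r: "r \<in> carrier k"
    note T = tuples_take_drop[OF us]
    show "f (take p (us @ (r \<odot>\<^bsub>A\<^esub> x) # vs)) \<otimes>\<^bsub>N\<^esub> g (drop p (us @ (r \<odot>\<^bsub>A\<^esub> x) # vs)) =
        r \<odot>\<^bsub>N\<^esub> (f (take p (us @ x # vs)) \<otimes>\<^bsub>N\<^esub> g (drop p (us @ x # vs)))"
    proof (cases "length us < p")
      case True
      then show ?thesis
        using T r by (simp only: take_append_Cons drop_append_Cons f_smult closed closed'
            N.smult_mult_left)
    next
      case False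
      then have "p \<le> length us" by simp
      then show ?thesis
        using T r by (simp only: take_append_Cons drop_append_Cons g_smult closed closed'
            N.smult_mult_right)
    qed
  qed
qed

lemma self_module_module: "cring k \<Longrightarrow> module k (self_module k)"
proof -
  assume "cring k"
  then interpret cring k .
  show ?thesis
    by (intro moduleI abelian_groupI)
      (auto simp: self_module_def is_cring l_distr r_distr m_assoc a_ac intro: l_neg a_inv_closed)
qed

lemma (in monoid) list_prod_closed: "set xs \<subseteq> carrier G \<Longrightarrow> list_prod G xs \<in> carrier G"
  by (induction xs) (auto simp: list_prod_def)

lemma (in monoid) list_prod_append:
  "\<lbrakk>set xs \<subseteq> carrier G; set ys \<subseteq> carrier G\<rbrakk> \<Longrightarrow>
    list_prod G (xs @ ys) = list_prod G xs \<otimes> list_prod G ys"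
proof (induction xs)
  case Nil
  then show ?case using list_prod_closed[of ys] by (simp add: list_prod_def)
next
  case (Cons x xs)
  then show ?case
    using list_prod_closed[of xs] list_prod_closed[of ys] by (simp add: list_prod_def m_assoc)
qed

section \<open>Products of cochains\<close>

context unital_algebra
begin

lemma
  assumes f: "f \<in> Hom_mod k (tensor_power k A p) A" and g: "g \<in> Hom_mod k (tensor_power k A q) A"
  shows gerstenhaber_cup_closed:
      "gerstenhaber_cup k A p q f g \<in> Hom_mod k (tensor_power k A (p + q)) A"
    and gerstenhaber_cup_pure_tensor:
      "\<lbrakk>us \<in> tuples p (carrier A); vs \<in> tuples q (carrier A)\<rbrakk> \<Longrightarrow>
      gerstenhaber_cup k A p q f g (pure_tensor k A (us @ vs))
        = f (pure_tensor k A us) \<otimes>\<^bsub>A\<^esub> g (pure_tensor k A vs)"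
proof -
  let ?P = "\<lambda>h. h \<in> Hom_mod k (tensor_power k A (p + q)) A \<and>
     (\<forall>us \<in> tuples p (carrier A). \<forall>vs \<in> tuples q (carrier A).
        h (pure_tensor k A (us @ vs)) = f (pure_tensor k A us) \<otimes>\<^bsub>A\<^esub> g (pure_tensor k A vs))"
  have "\<exists>!h. ?P h"
  proof (rule ex_ex1I)
    obtain h where h: "h \<in> Hom_mod k (tensor_power k A (p + q)) A"
      "\<And>xs. xs \<in> tuples (p + q) (carrier A) \<Longrightarrow> h (pure_tensor k A xs)
        = f (pure_tensor k A (take p xs)) \<otimes>\<^bsub>A\<^esub> g (pure_tensor k A (drop p xs))"
      by (rule tensor_lift[OF module_axioms multilinear_mult[OF unital_algebra_axioms
              Hom_mod_multilinear[OF f] Hom_mod_multilinear[OF g]]]) blast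
    have "?P h"
      using h by (auto simp: tuples_def)
    then show "\<exists>h. ?P h"
      by (rule exI[of ?P])
  next
    fix h h' assume "?P h" "?P h'"
    then have "\<forall>xs \<in> tuples (p + q) (carrier A). h (pure_tensor k A xs) = h' (pure_tensor k A xs)"
      unfolding ball_tuples_add by simp
    then show "h = h'"
      using \<open>?P h\<close> \<open>?P h'\<close> by (intro tensor_Hom_mod_eq[OF module_axioms]) auto
  qed
  from theI'[OF this, folded gerstenhaber_cup_def]
  show "gerstenhaber_cup k A p q f g \<in> Hom_mod k (tensor_power k A (p + q)) A"
    and "\<lbrakk>us \<in> tuples p (carrier A); vs \<in> tuples q (carrier A)\<rbrakk> \<Longrightarrow>
      gerstenhaber_cup k A p q f g (pure_tensor k A (us @ vs))
        = f (pure_tensor k A us) \<otimes>\<^bsub>A\<^esub> g (pure_tensor k A vs)"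
    by blast+
qed

context
  fixes \<Omega> :: "'i set" and \<phi> :: "'i \<Rightarrow> 'a"
  assumes basis: "free_basis k A \<Omega> \<phi>"
begin

lemma basis_tuples_subset: "tuples n (\<phi> ` \<Omega>) \<subseteq> tuples n (carrier A)"
  using basis_closed[OF basis] by (auto simp: tuples_def)

lemma Psi_ex1:
  assumes "\<And>bs. bs \<in> tuples n (\<phi> ` \<Omega>) \<Longrightarrow> \<alpha> (pure_tensor k A bs) \<in> carrier k"
  shows "\<exists>!f. f \<in> Hom_mod k (tensor_power k A n) A \<and> (\<forall>bs \<in> tuples n (\<phi> ` \<Omega>).
    f (pure_tensor k A bs) = \<alpha> (pure_tensor k A bs) \<odot>\<^bsub>A\<^esub> list_prod A bs)"
proof (rule tensor_Hom_mod_ex1_on_basis[OF basis module_axioms], rule funcsetI)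
  fix bs assume bs: "bs \<in> tuples n (\<phi> ` \<Omega>)"
  then have "set bs \<subseteq> carrier A"
    using basis_tuples_subset by (auto simp: tuples_def)
  then show "\<alpha> (pure_tensor k A bs) \<odot>\<^bsub>A\<^esub> list_prod A bs \<in> carrier A"
    using assms[OF bs] list_prod_closed by simp
qed

lemma
  assumes "\<And>bs. bs \<in> tuples n (\<phi> ` \<Omega>) \<Longrightarrow> \<alpha> (pure_tensor k A bs) \<in> carrier k"
  shows Psi_closed: "Psi k A (\<phi> ` \<Omega>) n \<alpha> \<in> Hom_mod k (tensor_power k A n) A"
    and Psi_basis: "bs \<in> tuples n (\<phi> ` \<Omega>) \<Longrightarrow> Psi k A (\<phi> ` \<Omega>) n \<alpha> (pure_tensor k A bs)
      = \<alpha> (pure_tensor k A bs) \<odot>\<^bsub>A\<^esub> list_prod A bs"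
  using theI'[OF Psi_ex1[where \<alpha> = \<alpha>, OF assms], folded Psi_def] by blast+

lemma Psi_eqI:
  assumes "\<And>bs. bs \<in> tuples n (\<phi> ` \<Omega>) \<Longrightarrow> \<alpha> (pure_tensor k A bs) \<in> carrier k"
    and "f \<in> Hom_mod k (tensor_power k A n) A"
    and "\<And>bs. bs \<in> tuples n (\<phi> ` \<Omega>) \<Longrightarrow>
      f (pure_tensor k A bs) = \<alpha> (pure_tensor k A bs) \<odot>\<^bsub>A\<^esub> list_prod A bs"
  shows "Psi k A (\<phi> ` \<Omega>) n \<alpha> = f"
  unfolding Psi_def by (rule the1_equality[OF Psi_ex1[where \<alpha> = \<alpha>, OF assms(1)]]) (use assms(2,3) in auto)

lemma Psi_AP:
  assumes "\<And>bs. bs \<in> tuples n (\<phi> ` \<Omega>) \<Longrightarrow> \<alpha> (pure_tensor k A bs) \<in> carrier k"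
  shows "Psi k A (\<phi> ` \<Omega>) n \<alpha> \<in> AP k A (\<phi> ` \<Omega>) n"
  unfolding AP_def
  using Psi_closed[where \<alpha> = \<alpha>, OF assms] Psi_basis[where \<alpha> = \<alpha>, OF assms] assms
  by blast

lemma cochain_closed:
  assumes "\<alpha> \<in> Hom_mod k (tensor_power k A n) (self_module k)" "xs \<in> tuples n (carrier A)"
  shows "\<alpha> (pure_tensor k A xs) \<in> carrier k"
  using Hom_mod_closed[OF assms(1) pure_tensor_closed[OF assms(2)]] by (simp add: self_module_def)

lemma simplicial_cup_basis:
  assumes \<alpha>: "\<alpha> \<in> Hom_mod k (tensor_power k A p) (self_module k)"
    and \<beta>: "\<beta> \<in> Hom_mod k (tensor_power k A q) (self_module k)"
    and us: "us \<in> tuples p (\<phi> ` \<Omega>)" and vs: "vs \<in> tuples q (\<phi> ` \<Omega>)"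
  shows "simplicial_cup k A (\<phi> ` \<Omega>) p q \<alpha> \<beta> (pure_tensor k A (us @ vs))
    = \<alpha> (pure_tensor k A us) \<otimes>\<^bsub>k\<^esub> \<beta> (pure_tensor k A vs)"
proof -
  let ?h = "\<lambda>xs. \<alpha> (pure_tensor k A (take p xs)) \<otimes>\<^bsub>k\<^esub> \<beta> (pure_tensor k A (drop p xs))"
  have "?h \<in> tuples (p + q) (\<phi> ` \<Omega>) \<rightarrow> carrier (self_module k)"
    using cochain_closed[OF \<alpha>] cochain_closed[OF \<beta>] basis_tuples_subset
      tuples_take_drop[of _ p q "\<phi> ` \<Omega>"]
    by (auto simp: self_module_def subset_iff)
  then have "\<exists>!\<gamma>. \<gamma> \<in> Hom_mod k (tensor_power k A (p + q)) (self_module k) \<and>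
      (\<forall>xs \<in> tuples (p + q) (\<phi> ` \<Omega>). \<gamma> (pure_tensor k A xs) = ?h xs)"
    by (rule tensor_Hom_mod_ex1_on_basis[OF basis self_module_module[OF R.is_cring]])
  moreover have "?h (us @ vs) = \<alpha> (pure_tensor k A us) \<otimes>\<^bsub>k\<^esub> \<beta> (pure_tensor k A vs)"
    if "us \<in> tuples p (\<phi> ` \<Omega>)" for us vs
    using that by (simp add: tuples_def)
  ultimately have "\<exists>!\<gamma>. \<gamma> \<in> Hom_mod k (tensor_power k A (p + q)) (self_module k) \<and>
      (\<forall>us \<in> tuples p (\<phi> ` \<Omega>). \<forall>vs \<in> tuples q (\<phi> ` \<Omega>).
         \<gamma> (pure_tensor k A (us @ vs)) = \<alpha> (pure_tensor k A us) \<otimes>\<^bsub>k\<^esub> \<beta> (pure_tensor k A vs))"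
    unfolding ball_tuples_add by (simp cong: ball_cong)
  from theI'[OF this, folded simplicial_cup_def] us vs show ?thesis
    by blast
qed

end

end

section \<open>Multiplicativity\<close>

theorem lemma3p6:
  fixes k :: "('r, 'm) ring_scheme"
    and A :: "('r, 'a, 'n) module_scheme"
    and \<Omega> :: "'i set"
    and \<phi> :: "'i \<Rightarrow> 'a"
    and p q :: nat
    and \<alpha> \<beta> :: "('a list \<Rightarrow> 'r) set \<Rightarrow> 'r"
  assumes "cring k"
    and "unital_algebra k A"
    and "free_basis k A \<Omega> \<phi>"
    and "\<forall>i \<in> \<Omega>. \<forall>j \<in> \<Omega>. \<exists>m \<in> \<Omega>. \<exists>\<mu> \<in> carrier k.
           \<mu> \<otimes>\<^bsub>k\<^esub> \<mu> = \<mu> \<and> \<phi> i \<otimes>\<^bsub>A\<^esub> \<phi> j = \<mu> \<odot>\<^bsub>A\<^esub> \<phi> m"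
    and "\<alpha> \<in> Hom_mod k (tensor_power k A p) (self_module k)"
    and "\<beta> \<in> Hom_mod k (tensor_power k A q) (self_module k)"
  shows "Psi k A (\<phi> ` \<Omega>) p \<alpha> \<in> AP k A (\<phi> ` \<Omega>) p \<and>
    Psi k A (\<phi> ` \<Omega>) q \<beta> \<in> AP k A (\<phi> ` \<Omega>) q \<and>
    Psi k A (\<phi> ` \<Omega>) (p + q) (simplicial_cup k A (\<phi> ` \<Omega>) p q \<alpha> \<beta>) =
      gerstenhaber_cup k A p q (Psi k A (\<phi> ` \<Omega>) p \<alpha>) (Psi k A (\<phi> ` \<Omega>) q \<beta>)"
proof -
  interpret unital_algebra k A by fact
  let ?B = "\<phi> ` \<Omega>"
  let ?\<gamma> = "simplicial_cup k A ?B p q \<alpha> \<beta>"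
  note basis = \<open>free_basis k A \<Omega> \<phi>\<close>
  note B = subsetD[OF basis_tuples_subset[OF basis]]
  note \<alpha> = cochain_closed[OF basis assms(5) B] and \<beta> = cochain_closed[OF basis assms(6) B]
  note cup = simplicial_cup_basis[OF basis assms(5,6)]
  note Psi_closed = Psi_closed[OF basis, where \<alpha> = \<alpha>, OF \<alpha>]
    Psi_closed[OF basis, where \<alpha> = \<beta>, OF \<beta>]
  have "\<forall>bs \<in> tuples (p + q) ?B. ?\<gamma> (pure_tensor k A bs) \<in> carrier k"
    unfolding ball_tuples_add using \<alpha> \<beta> by (simp add: cup)
  moreover have "\<forall>bs \<in> tuples (p + q) ?B.
      gerstenhaber_cup k A p q (Psi k A ?B p \<alpha>) (Psi k A ?B q \<beta>) (pure_tensor k A bs)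
        = ?\<gamma> (pure_tensor k A bs) \<odot>\<^bsub>A\<^esub> list_prod A bs"
    unfolding ball_tuples_add
  proof (intro ballI)
    fix us vs assume us: "us \<in> tuples p ?B" and vs: "vs \<in> tuples q ?B"
    have set: "set us \<subseteq> carrier A" "set vs \<subseteq> carrier A"
      using B[OF us] B[OF vs] by (simp_all add: tuples_def)
    note closed = \<alpha>[OF us] \<beta>[OF vs] list_prod_closed[OF set(1)] list_prod_closed[OF set(2)]
    have "gerstenhaber_cup k A p q (Psi k A ?B p \<alpha>) (Psi k A ?B q \<beta>) (pure_tensor k A (us @ vs))
        = (\<alpha> (pure_tensor k A us) \<odot>\<^bsub>A\<^esub> list_prod A us) \<otimes>\<^bsub>A\<^esub>
          (\<beta> (pure_tensor k A vs) \<odot>\<^bsub>A\<^esub> list_prod A vs)"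
      using gerstenhaber_cup_pure_tensor[OF Psi_closed B[OF us] B[OF vs]]
      by (simp add: Psi_basis[OF basis, where \<alpha> = \<alpha>, OF \<alpha> us]
          Psi_basis[OF basis, where \<alpha> = \<beta>, OF \<beta> vs])
    also have "\<dots> = (\<alpha> (pure_tensor k A us) \<otimes>\<^bsub>k\<^esub> \<beta> (pure_tensor k A vs)) \<odot>\<^bsub>A\<^esub>
        (list_prod A us \<otimes>\<^bsub>A\<^esub> list_prod A vs)"
      using closed by (simp add: smult_mult_left smult_mult_right smult_assoc1[symmetric] R.m_comm)
    also have "\<dots> = ?\<gamma> (pure_tensor k A (us @ vs)) \<odot>\<^bsub>A\<^esub> list_prod A (us @ vs)"
      by (simp add: cup[OF us vs] list_prod_append[OF set])
    finally show "gerstenhaber_cup k A p q (Psi k A ?B p \<alpha>) (Psi k A ?B q \<beta>)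
        (pure_tensor k A (us @ vs)) = ?\<gamma> (pure_tensor k A (us @ vs)) \<odot>\<^bsub>A\<^esub> list_prod A (us @ vs)" .
  qed
  ultimately have "Psi k A ?B (p + q) ?\<gamma>
      = gerstenhaber_cup k A p q (Psi k A ?B p \<alpha>) (Psi k A ?B q \<beta>)"
    by (intro Psi_eqI[OF basis] gerstenhaber_cup_closed[OF Psi_closed]) auto
  then show ?thesis
    using Psi_AP[OF basis, where \<alpha> = \<alpha>, OF \<alpha>] Psi_AP[OF basis, where \<alpha> = \<beta>, OF \<beta>] by blast
qed

end
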